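(* For every dimension $n\geq 1$, the circumradius $R_1$ of the convex hull of standard Brownian motion in $\mathbb{R}^n$ run up to time $1$ satisfies \[ \frac{1}{2}\sqrt{n}\;\leq\;\mathbb{E}\left[R_1\right]\;\leq\; \sqrt{\log 2}\,\sqrt{n}. \]
   Context: Let $\boldsymbol{W}=\{\boldsymbol{W}_t:t\geq 0\}$ be standard Brownian motion in $\mathbb{R}^n$ started at the origin, i.e. $\boldsymbol{W}_t=(W_t^{(1)},\dots,W_t^{(n)})$ where the coordinates are independent standard one-dimensional Brownian motions. Let $\mathcal{H}_t:=\operatorname{conv}\{\boldsymbol{W}_s:0\leq s\leq t\}$ be the convex hull of the path up to time $t$ (almost surely a nonempty compact convex set). Let $R_t:=R(\mathcal{H}_t)$, where $R(\mathcal{K})$ denotes the circumradius of $\mathcal{K}$, i.e. the radius of the smallest closed Euclidean ball containing $\mathcal{K}$. $\log$ is the natural logarithm. *)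

theory Defs
  imports "HOL-Probability.Probability"
begin

text \<open>
  Time is modelled by the nonnegative reals; the values \<open>B t\<close> for \<open>t < 0\<close> are irrelevant.
  The starting value and path continuity are only required almost surely. The second argument of
  \<^const>\<open>normal_density\<close> is the standard deviation.
\<close>

locale standard_brownian_motion_1d = prob_space M
  for M :: "'w measure" and B :: "real \<Rightarrow> 'w \<Rightarrow> real" +
  assumes measurable_B: "\<And>t. 0 \<le> t \<Longrightarrow> B t \<in> borel_measurable M"
    and start_zero: "AE \<omega> in M. B 0 \<omega> = 0"
    and indep_increments:
      "\<And>(k::nat) (t::nat \<Rightarrow> real). 0 \<le> t 0 \<Longrightarrow> (\<And>i. i < k \<Longrightarrow> t i \<le> t (Suc i)) \<Longrightarrow>
        indep_vars (\<lambda>_. borel) (\<lambda>i \<omega>. B (t (Suc i)) \<omega> - B (t i) \<omega>) {..<k}"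
    and normal_increments:
      "\<And>s t. 0 \<le> s \<Longrightarrow> s < t \<Longrightarrow>
        distributed M lborel (\<lambda>\<omega>. B t \<omega> - B s \<omega>) (normal_density 0 (sqrt (t - s)))"
    and continuous_paths: "AE \<omega> in M. continuous_on {0..} (\<lambda>t. B t \<omega>)"

text \<open>
  The coordinate processes are independent as random elements of the path space
  \<open>\<real>\<^bsup>[0,\<infinity>)\<^esup>\<close> with its product \<open>\<sigma>\<close>-algebra.
\<close>

locale standard_brownian_motion = prob_space M
  for M :: "'w measure" and W :: "real \<Rightarrow> 'w \<Rightarrow> real ^ 'n" +
  assumes coordinate_brownian: "\<And>i. standard_brownian_motion_1d M (\<lambda>t \<omega>. W t \<omega> $ i)"
    and indep_coordinates:
      "indep_vars (\<lambda>_. PiM {0..} (\<lambda>_. borel)) (\<lambda>i \<omega>. \<lambda>t\<in>{0..}. W t \<omega> $ i) UNIV"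

definition path_hull :: "(real \<Rightarrow> 'w \<Rightarrow> 'a::real_vector) \<Rightarrow> real \<Rightarrow> 'w \<Rightarrow> 'a set" where
  "path_hull W t \<omega> = convex hull ((\<lambda>s. W s \<omega>) ` {0..t})"

text \<open>
  For nonempty bounded sets the minimum exists; for unbounded sets the value is unspecified.
\<close>

definition circumradius :: "'a::euclidean_space set \<Rightarrow> real" where
  "circumradius K = (LEAST r. 0 \<le> r \<and> (\<exists>c. K \<subseteq> cball c r))"

text \<open>
  As paths are continuous only almost surely, the circumradius of the hull is a random variable
  up to null sets, that is, with respect to the completed measure. If it is measurable
  with respect to the original measure, the two expectations agree (\<open>integral_completion\<close>).
\<close>

definition expected_circumradius :: "'w measure \<Rightarrow> (real \<Rightarrow> 'w \<Rightarrow> 'a::euclidean_space) \<Rightarrow> real \<Rightarrow> real"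
  where "expected_circumradius M W t =
    (\<integral>\<omega>. circumradius (path_hull W t \<omega>) \<partial>completion M)"

end

theory Submission
  imports Defs "HOL-Real_Asymp.Real_Asymp"
begin

text \<open>
  Both bounds come down to one-dimensional or radial functionals of a Gaussian random walk that are
  accessible after a randomisation of time, and Brownian scaling carries the result back to time
  \<open>1\<close>.

  \<^emph>\<open>Upper bound.\<close> The hull lies in its bounding box, so \<open>4 R\<^sup>2\<close> is at most the sum of the squared
  ranges of the coordinates, and it suffices that the squared range of a one-dimensional Brownian
  motion up to time \<open>1\<close> has mean at most \<open>4 ln 2\<close>; the inequality
  \<open>R \<le> R\<^sup>2 / (2 c) + c / 2\<close> with \<open>c = sqrt (n ln 2)\<close> then bounds the first moment. For the range, stop at an
  independent exponential time. The conditional expectation of the squared range at that time, given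
  the present position and the present extremes, solves a linear ordinary differential equation with
  Neumann conditions and is explicit (\<open>range_value\<close>); at the start it equals \<open>2 ln 2\<close> in the
  normalisation used here. Across the extremes this function only loses convexity, so a Sturm
  comparison with \<open>cosh\<close> (\<open>symmetric_range_value_step\<close>) shows that it decreases in the required way even
  along a Gaussian walk that is observed at discrete times, without any error term
  (\<open>range_value_normal_step\<close>). Summation yields \<open>geometric_mean_sq_range_le\<close>; scaling, the limit of
  vanishing killing rate and Fatou's lemma yield the constant \<open>4 ln 2\<close>.

  \<^emph>\<open>Lower bound.\<close> Since the path starts at the origin, \<open>Y = 2 R\<close> dominates \<open>norm (W t)\<close> for all
  \<open>t \<le> 1\<close>. The classical argument says that the exit time of the unit ball has mean \<open>1 / n\<close> and
  is distributed as \<open>S powr (-2)\<close>, where \<open>S\<close> is the largest norm attained by the path up to time \<open>1\<close>, and that \<open>S\<close>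
  therefore has mean at least \<open>sqrt n\<close> by Jensen's inequality. Here the exit time is the one of a
  Gaussian walk with unit steps from a large ball of radius \<open>r\<close>: the expected number of steps that the
  walk stays inside is at most \<open>r\<^sup>2 / n\<close> up to an overshoot of lower order
  (\<open>confinement_sum_le\<close>). By scaling, the \<open>k\<close>-th term of that expectation dominates the probability of
  \<open>Y * sqrt k < r\<close>, and the number of such \<open>k\<close> is at least \<open>(r / Y)\<^sup>2\<close>. As \<open>r\<close> grows this
  gives mean at most \<open>1 / n\<close> for \<open>Y powr (-2)\<close> (\<open>sqrt_dim_le_expectation\<close>).
\<close>

section \<open>Sturm comparison with the hyperbolic cosine\<close>

text \<open>
  Finitely many exceptional points are allowed because the function to which this is applied has a
  second derivative that jumps when the path leaves its present range.
\<close>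

lemma decreasing_if_deriv_nonpos_off_finite:
  fixes f f' :: "real \<Rightarrow> real"
  assumes S: "finite S" and ab: "a \<le> b" and cont: "continuous_on {a..b} f"
    and deriv: "\<And>x. x \<in> {a<..<b} - S \<Longrightarrow> (f has_real_derivative f' x) (at x)"
    and nonpos: "\<And>x. x \<in> {a<..<b} - S \<Longrightarrow> f' x \<le> 0"
  shows "f b \<le> f a"
proof -
  define g where "g x = (if x \<in> {a<..<b} - S then f' x else 0)" for x
  have "(g has_integral (f b - f a)) {a..b}"
    by (rule fundamental_theorem_of_calculus_interior_strong[OF S ab _ cont])
      (use deriv in \<open>auto simp: g_def has_real_derivative_iff_has_vector_derivative\<close>)
  then have "f b - f a \<le> 0"
    using has_integral_le[OF _ has_integral_0, of g "f b - f a"] nonpos by (simp add: g_def)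
  then show ?thesis by simp
qed

text \<open>
  The function \<open>w = h' cosh - h cosh'\<close> (with argument \<open>2 x\<close>) has derivative
  \<open>(h'' - 4 h) cosh \<le> 0\<close> and starts at a nonpositive value; as \<open>w\<close> is the numerator of the derivative
  of \<open>h / cosh\<close>, that quotient decreases.
\<close>

lemma cosh_comparison:
  fixes h h' h'' :: "real \<Rightarrow> real"
  assumes S: "finite S" and z: "0 \<le> z"
    and cont: "continuous_on {0..z} h" "continuous_on {0..z} h'"
    and deriv: "\<And>x. x \<in> {0<..<z} - S \<Longrightarrow> (h has_real_derivative h' x) (at x)"
      "\<And>x. x \<in> {0<..<z} - S \<Longrightarrow> (h' has_real_derivative h'' x) (at x)"
    and convex: "\<And>x. x \<in> {0<..<z} - S \<Longrightarrow> h'' x \<le> 4 * h x"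
    and start: "h' 0 \<le> 0"
  shows "h z \<le> h 0 * cosh (2 * z)"
proof -
  define w where "w x = h' x * cosh (2 * x) - 2 * h x * sinh (2 * x)" for x
  have w: "w x \<le> 0" if x: "x \<in> {0..z}" for x
  proof -
    have sub: "{0..x} \<subseteq> {0..z}" using x by auto
    have "w x \<le> w 0"
    proof (rule decreasing_if_deriv_nonpos_off_finite[OF S, where f = w])
      show "0 \<le> x" using x by simp
      show "continuous_on {0..x} w"
        unfolding w_def
        by (intro continuous_intros continuous_on_subset[OF cont(1) sub]
            continuous_on_subset[OF cont(2) sub])
      show "(w has_real_derivative (h'' u - 4 * h u) * cosh (2 * u)) (at u)"
        if "u \<in> {0<..<x} - S" for u
      proof -
        have u: "u \<in> {0<..<z} - S" using that x by auto
        show ?thesis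
          unfolding w_def
          by (rule derivative_eq_intros deriv[OF u] refl)+ (simp add: algebra_simps)
      qed
      show "(h'' u - 4 * h u) * cosh (2 * u) \<le> 0" if "u \<in> {0<..<x} - S" for u
        using convex[of u] that x by (auto intro!: mult_nonpos_nonneg)
    qed
    then show ?thesis using start by (simp add: w_def)
  qed
  have "h z / cosh (2 * z) \<le> h 0 / cosh (2 * 0)"
  proof (rule decreasing_if_deriv_nonpos_off_finite[OF S z, where f = "\<lambda>x. h x / cosh (2 * x)"])
    show "continuous_on {0..z} (\<lambda>x. h x / cosh (2 * x))"
      by (intro continuous_intros cont) auto
    show "((\<lambda>x. h x / cosh (2 * x)) has_real_derivative w u / (cosh (2 * u) * cosh (2 * u))) (at u)"
      if u: "u \<in> {0<..<z} - S" for u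
      by (rule derivative_eq_intros deriv[OF u] refl | simp)+ (simp add: w_def algebra_simps)
    show "w u / (cosh (2 * u) * cosh (2 * u)) \<le> 0" if "u \<in> {0<..<z} - S" for u
      using w[of u] that by (auto intro!: divide_nonpos_nonneg)
  qed
  then show ?thesis by (simp add: field_simps)
qed

text \<open>
  The even part of \<open>H\<close> around \<open>y\<close> satisfies the same differential inequality and has vanishing
  derivative at the centre. Averaging over a symmetric random displacement therefore costs at most
  the factor that it costs \<open>cosh\<close>.
\<close>

lemma symmetric_cosh_comparison:
  fixes H H' H'' :: "real \<Rightarrow> real"
  assumes S: "finite S"
    and cont: "continuous_on UNIV H" "continuous_on UNIV H'"
    and deriv: "\<And>x. x \<notin> S \<Longrightarrow> (H has_real_derivative H' x) (at x)"
      "\<And>x. x \<notin> S \<Longrightarrow> (H' has_real_derivative H'' x) (at x)"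
    and convex: "\<And>x. x \<notin> S \<Longrightarrow> H'' x \<le> 4 * H x"
  shows "H (y + z) + H (y - z) \<le> 2 * H y * cosh (2 * z)"
proof -
  have nonneg: "H (y + z) + H (y - z) \<le> 2 * H y * cosh (2 * z)" if "0 \<le> z" for z
  proof -
    have fin: "finite ((\<lambda>s. s - y) ` S \<union> (\<lambda>s. y - s) ` S)" (is "finite ?S")
      using S by simp
    have off: "y + x \<notin> S" "y - x \<notin> S" if "x \<in> {0<..<z} - ?S" for x
      using that by (force simp: image_iff)+
    have "H (y + z) + H (y - z) \<le> (H (y + 0) + H (y - 0)) * cosh (2 * z)"
    proof (rule cosh_comparison[OF fin \<open>0 \<le> z\<close>,
          where h' = "\<lambda>x. H' (y + x) - H' (y - x)" and h'' = "\<lambda>x. H'' (y + x) + H'' (y - x)"])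
      show "continuous_on {0..z} (\<lambda>x. H (y + x) + H (y - x))"
        by (intro continuous_intros continuous_on_compose2[OF cont(1)]) auto
      show "continuous_on {0..z} (\<lambda>x. H' (y + x) - H' (y - x))"
        by (intro continuous_intros continuous_on_compose2[OF cont(2)]) auto
      fix x assume x: "x \<in> {0<..<z} - ?S"
      have chain: "((\<lambda>x. G (y + x)) has_real_derivative G' (y + x)) (at x)"
          "((\<lambda>x. G (y - x)) has_real_derivative - G' (y - x)) (at x)"
        if "\<And>x. x \<notin> S \<Longrightarrow> (G has_real_derivative G' x) (at x)" for G G'
        using DERIV_chain2[where g = "\<lambda>x. y + x" and x = x, OF that[OF off(1)[OF x]]]
          DERIV_chain2[where g = "\<lambda>x. y - x" and x = x, OF that[OF off(2)[OF x]]]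
        by (fastforce intro!: derivative_eq_intros)+
      show "((\<lambda>x. H (y + x) + H (y - x)) has_real_derivative H' (y + x) - H' (y - x)) (at x)"
        using DERIV_add[OF chain[OF deriv(1)]] by simp
      show "((\<lambda>x. H' (y + x) - H' (y - x)) has_real_derivative H'' (y + x) + H'' (y - x)) (at x)"
        using DERIV_diff[OF chain[OF deriv(2)]] by simp
      show "H'' (y + x) + H'' (y - x) \<le> 4 * (H (y + x) + H (y - x))"
        using convex[OF off(1)[OF x]] convex[OF off(2)[OF x]] by simp
    qed simp
    then show ?thesis by simp
  qed
  show ?thesis
    using nonneg[of z] nonneg[of "- z"] by (cases "0 \<le> z") (auto simp: algebra_simps)
qed

section \<open>The expected squared range at an exponential time\<close>

text \<open>
  This is the solution of \<open>D' = 2 tanh l D - 2 l\<close> that grows only linearly, namely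
  \<open>cosh\<^sup>2 l\<close> times the integral of \<open>2 x / cosh\<^sup>2 x\<close> over \<open>x \<ge> l\<close>. It is the expected increase
  of the squared range until an exponential time when the motion sits at an end point of a range of
  length \<open>l\<close>. Lengths are measured in units in which, as a function of the position inside
  the range \<open>[a, b]\<close>, the expected squared range solves \<open>f'' = 4 (f - (b - a)\<^sup>2)\<close>.
\<close>

definition excess :: "real \<Rightarrow> real" where
  "excess l = (cosh l)\<^sup>2 * (2 * ln 2 + 2 * ln (cosh l) - 2 * l * tanh l)"

lemma excess_0: "excess 0 = 2 * ln 2"
  by (simp add: excess_def)

lemma excess_nonneg:
  assumes "0 \<le> l"
  shows "0 \<le> excess l"
proof -
  have "l \<le> ln (2 * cosh l)"
    by (subst ln_ge_iff) (auto simp: cosh_def add_pos_pos)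
  also have "\<dots> = ln 2 + ln (cosh l)"
    by (simp add: ln_mult)
  finally have "l \<le> ln 2 + ln (cosh l)" .
  moreover have "l * tanh l \<le> l"
    using assms tanh_real_bounds[of l] by (auto intro!: mult_left_le simp: less_imp_le)
  ultimately show ?thesis
    unfolding excess_def by (intro mult_nonneg_nonneg) auto
qed

lemma excess_deriv:
  "(excess has_real_derivative 2 * tanh l * excess l - 2 * l) (at l)"
proof -
  have c: "cosh l \<noteq> 0" by simp
  have sq: "(sinh l)\<^sup>2 = (cosh l)\<^sup>2 - 1"
    by (simp add: sinh_square_eq)
  have "(excess has_real_derivative
      2 * cosh l * sinh l * (2 * ln 2 + 2 * ln (cosh l) - 2 * l * tanh l)
      + (cosh l)\<^sup>2 * (2 * (sinh l / cosh l) - (2 * tanh l + 2 * l * (1 - (tanh l)\<^sup>2)))) (at l)"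
    unfolding excess_def[abs_def]
    by (rule derivative_eq_intros refl | simp)+
  moreover have "(cosh l)\<^sup>2 * (2 * (sinh l / cosh l) - (2 * tanh l + 2 * l * (1 - (tanh l)\<^sup>2))) = - 2 * l"
  proof -
    have one: "(cosh l)\<^sup>2 * (1 - (tanh l)\<^sup>2) = 1"
      using sq by (simp add: tanh_def power_divide algebra_simps)
    have "(cosh l)\<^sup>2 * (2 * (sinh l / cosh l) - (2 * tanh l + 2 * l * (1 - (tanh l)\<^sup>2)))
        = - 2 * l * ((cosh l)\<^sup>2 * (1 - (tanh l)\<^sup>2))"
      by (simp add: tanh_def)
    then show ?thesis unfolding one by simp
  qed
  moreover have "2 * cosh l * sinh l * X = 2 * tanh l * ((cosh l)\<^sup>2 * X)" for X
    by (simp add: tanh_def power2_eq_square)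
  ultimately have "(excess has_real_derivative 2 * tanh l * excess l + (- 2 * l)) (at l)"
    unfolding excess_def by (simp only:)
  then show ?thesis by simp
qed

lemma excess_continuous: "continuous_on A excess"
  by (rule DERIV_continuous_on[OF has_field_derivative_at_within[OF excess_deriv]])

text \<open>
  The expected squared range at the exponential time for a motion at \<open>y\<close> that has so far visited
  \<open>[a, b]\<close>: the present squared range, plus the excess weighted by the probability of reaching the
  boundary before the motion is killed.
\<close>

definition range_value :: "real \<Rightarrow> real \<Rightarrow> real \<Rightarrow> real" where
  "range_value y a b = (b - a)\<^sup>2 + excess (b - a) * cosh (2 * y - a - b) / cosh (b - a)"

lemma range_value_nonneg: "a \<le> b \<Longrightarrow> 0 \<le> range_value y a b"
  unfolding range_value_def by (auto intro!: add_nonneg_nonneg mult_nonneg_nonneg divide_nonneg_pos excess_nonneg)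

lemma range_value_0: "range_value 0 0 0 = 2 * ln 2"
  by (simp add: range_value_def excess_0)

text \<open>
  At a boundary point the value depends on the range alone. The second derivative found here is at
  most \<open>4 * excess l\<close>, which is the value that it has just inside the range; this is why no
  convexity is gained when the range expands.
\<close>

lemma range_value_deriv_outside:
  "((\<lambda>l. l\<^sup>2 + excess l) has_real_derivative 2 * tanh l * excess l) (at l)"
  "((\<lambda>l. 2 * tanh l * excess l) has_real_derivative
     (2 + 2 * (tanh l)\<^sup>2) * excess l - 4 * l * tanh l) (at l)"
  by (rule derivative_eq_intros excess_deriv refl | simp)+
     (simp add: algebra_simps power2_eq_square)

text \<open>
  With the old range \<open>[a, b]\<close> fixed, \<open>H y = range_value y (min a y) (max b y) - (b - a)\<^sup>2\<close> is
  continuously differentiable (this is the Neumann condition) and satisfies \<open>H'' \<le> 4 H\<close> on both sides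
  of the end points, so \<open>symmetric_cosh_comparison\<close> applies.
\<close>

lemma symmetric_range_value_step:
  assumes "a \<le> b"
  shows "range_value (y + z) (min a (y + z)) (max b (y + z)) +
      range_value (y - z) (min a (y - z)) (max b (y - z)) + 2 * (cosh (2 * z) - 1) * (b - a)\<^sup>2
    \<le> 2 * cosh (2 * z) * range_value y (min a y) (max b y)"
proof -
  define L where "L y = max b y - min a y" for y
  define H where "H y = range_value y (min a y) (max b y) - (b - a)\<^sup>2" for y
  \<comment> \<open>One formula covers all three regions, since the argument of sinh equals the range length up to sign outside.\<close>
  define H' where "H' y = 2 * (excess (L y) * sinh (2 * y - min a y - max b y) / cosh (L y))" for y
  define H'' where "H'' y = (if y \<in> {a..b} then 4 * H y
     else (2 + 2 * (tanh (L y))\<^sup>2) * excess (L y) - 4 * L y * tanh (L y))" for y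
  have contL: "continuous_on UNIV L"
    unfolding L_def by (intro continuous_intros)
  have inside: "L y = b - a" "min a y = a" "max b y = b" if "y \<in> {a..b}" for y
    using that by (auto simp: L_def)
  have above: "L y = y - a" "min a y = a" "max b y = y" if "b < y" for y
    using that assms by (auto simp: L_def)
  have below: "L y = b - y" "min a y = y" "max b y = b" if "y < a" for y
    using that assms by (auto simp: L_def)
  have H_above: "H y = (y - a)\<^sup>2 + excess (y - a) - (b - a)\<^sup>2" "H' y = 2 * tanh (y - a) * excess (y - a)"
    if "b < y" for y
    using above[OF that] by (simp_all add: H_def H'_def range_value_def tanh_def)
  have H_below: "H y = (b - y)\<^sup>2 + excess (b - y) - (b - a)\<^sup>2" "H' y = - (2 * tanh (b - y) * excess (b - y))"
    if "y < a" for y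
  proof -
    have e: "2 * y - y - b = - (b - y)" by simp
    show "H y = (b - y)\<^sup>2 + excess (b - y) - (b - a)\<^sup>2" "H' y = - (2 * tanh (b - y) * excess (b - y))"
      unfolding H_def H'_def range_value_def below[OF that] e by (simp_all add: tanh_def del: minus_diff_eq)
  qed
  have "H (y + z) + H (y - z) \<le> 2 * H y * cosh (2 * z)"
  proof (rule symmetric_cosh_comparison[where S = "{a, b}" and H' = H' and H'' = H''])
    show "continuous_on UNIV H"
      unfolding H_def range_value_def
      by (intro continuous_intros continuous_on_compose2[OF excess_continuous[of UNIV]]) auto
    show "continuous_on UNIV H'"
      unfolding H'_def
      by (intro continuous_intros continuous_on_compose2[OF excess_continuous[of UNIV]] contL) auto
    fix x assume "x \<notin> {a, b}"
    then consider "x < a" | "a < x" "x < b" | "b < x" by force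
    then have "(H has_real_derivative H' x) (at x) \<and> (H' has_real_derivative H'' x) (at x) \<and> H'' x \<le> 4 * H x"
    proof cases
      case 1
      have d: "((\<lambda>y. b - y) has_real_derivative - 1) (at x)"
        by (auto intro!: derivative_eq_intros)
      have ev: "\<forall>\<^sub>F y in nhds x. y < a"
        using 1 by (simp add: eventually_nhds_in_open[of "{..<a}", simplified])
      have "((\<lambda>y. (b - y)\<^sup>2 + excess (b - y) - (b - a)\<^sup>2) has_real_derivative H' x) (at x)"
        using DERIV_diff[OF DERIV_chain2[OF range_value_deriv_outside(1) d] DERIV_const]
        by (simp add: H_below(2)[OF 1])
      then have 1: "(H has_real_derivative H' x) (at x)"
        by (subst DERIV_cong_ev[OF refl _ refl]) (use ev H_below(1) in \<open>auto elim: eventually_mono\<close>)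
      have "((\<lambda>y. - (2 * tanh (b - y) * excess (b - y))) has_real_derivative H'' x) (at x)"
        using DERIV_minus[OF DERIV_chain2[OF range_value_deriv_outside(2) d]]
        using \<open>x < a\<close> by (simp add: H''_def below)
      then have 2: "(H' has_real_derivative H'' x) (at x)"
        by (subst DERIV_cong_ev[OF refl _ refl]) (use ev H_below(2) in \<open>auto elim: eventually_mono\<close>)
      have l: "0 \<le> b - x" "b - a \<le> b - x" using \<open>x < a\<close> assms by auto
      have "(tanh (b - x))\<^sup>2 \<le> 1"
        using tanh_real_bounds[of "b - x"] by (simp add: abs_square_le_1 abs_le_iff less_imp_le)
      then have "(2 + 2 * (tanh (b - x))\<^sup>2) * excess (b - x) \<le> 4 * excess (b - x)"
        using excess_nonneg[OF l(1)] by (intro mult_right_mono) auto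
      moreover have "0 \<le> 4 * (b - x) * tanh (b - x)" using l by simp
      moreover have "(b - a)\<^sup>2 \<le> (b - x)\<^sup>2" using l assms by (intro power_mono) auto
      ultimately have "H'' x \<le> 4 * H x"
        using \<open>x < a\<close> by (simp add: H''_def below H_below(1))
      with 1 2 show ?thesis by blast
    next
      case 2
      have ev: "\<forall>\<^sub>F y in nhds x. y \<in> {a<..<b}"
        using 2 by (intro eventually_nhds_in_open) auto
      have "((\<lambda>y. excess (b - a) * cosh (2 * y - a - b) / cosh (b - a)) has_real_derivative
          2 * (excess (b - a) * sinh (2 * x - a - b) / cosh (b - a))) (at x)"
        by (rule derivative_eq_intros refl | simp)+
      then have "((\<lambda>y. excess (b - a) * cosh (2 * y - a - b) / cosh (b - a)) has_real_derivative H' x) (at x)"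
        using 2 by (simp add: H'_def inside)
      then have 3: "(H has_real_derivative H' x) (at x)"
        by (subst DERIV_cong_ev[OF refl _ refl])
          (use ev in \<open>auto elim!: eventually_mono simp: H_def inside range_value_def\<close>)
      have "((\<lambda>y. 2 * (excess (b - a) * sinh (2 * y - a - b) / cosh (b - a))) has_real_derivative
          4 * (excess (b - a) * cosh (2 * x - a - b) / cosh (b - a))) (at x)"
        by (rule derivative_eq_intros refl | simp)+
      then have "((\<lambda>y. 2 * (excess (b - a) * sinh (2 * y - a - b) / cosh (b - a))) has_real_derivative H'' x) (at x)"
        using 2 by (simp add: H''_def H_def inside range_value_def)
      then have 4: "(H' has_real_derivative H'' x) (at x)"
        by (subst DERIV_cong_ev[OF refl _ refl])
          (use ev in \<open>auto elim!: eventually_mono simp: H'_def inside\<close>)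
      show ?thesis using 2 3 4 by (simp add: H''_def)
    next
      case 3
      have d: "((\<lambda>y. y - a) has_real_derivative 1) (at x)"
        by (auto intro!: derivative_eq_intros)
      have ev: "\<forall>\<^sub>F y in nhds x. b < y"
        using 3 by (simp add: eventually_nhds_in_open[of "{b<..}", simplified])
      have "((\<lambda>y. (y - a)\<^sup>2 + excess (y - a) - (b - a)\<^sup>2) has_real_derivative H' x) (at x)"
        using DERIV_diff[OF DERIV_chain2[OF range_value_deriv_outside(1) d] DERIV_const]
        by (simp add: H_above(2)[OF 3])
      then have 1: "(H has_real_derivative H' x) (at x)"
        by (subst DERIV_cong_ev[OF refl _ refl]) (use ev H_above(1) in \<open>auto elim: eventually_mono\<close>)
      have "((\<lambda>y. 2 * tanh (y - a) * excess (y - a)) has_real_derivative H'' x) (at x)"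
        using DERIV_chain2[OF range_value_deriv_outside(2) d] 3 by (simp add: H''_def above)
      then have 2: "(H' has_real_derivative H'' x) (at x)"
        by (subst DERIV_cong_ev[OF refl _ refl]) (use ev H_above(2) in \<open>auto elim: eventually_mono\<close>)
      have l: "0 \<le> x - a" "b - a \<le> x - a" using 3 assms by auto
      have "(tanh (x - a))\<^sup>2 \<le> 1"
        using tanh_real_bounds[of "x - a"] by (simp add: abs_square_le_1 abs_le_iff less_imp_le)
      then have "(2 + 2 * (tanh (x - a))\<^sup>2) * excess (x - a) \<le> 4 * excess (x - a)"
        using excess_nonneg[OF l(1)] by (intro mult_right_mono) auto
      moreover have "0 \<le> 4 * (x - a) * tanh (x - a)" using l by simp
      moreover have "(b - a)\<^sup>2 \<le> (x - a)\<^sup>2" using l assms by (intro power_mono) auto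
      ultimately have "H'' x \<le> 4 * H x"
        using 3 by (simp add: H''_def above H_above(1))
      with 1 2 show ?thesis by blast
    qed
    then show "(H has_real_derivative H' x) (at x)" "(H' has_real_derivative H'' x) (at x)" "H'' x \<le> 4 * H x"
      by blast+
  qed simp
  then show ?thesis
    by (simp add: H_def algebra_simps)
qed

section \<open>The range of a Gaussian random walk\<close>

definition centered_normal :: "real \<Rightarrow> real measure" where
  "centered_normal \<sigma> = density lborel (normal_density 0 \<sigma>)"

lemma space_centered_normal [simp]: "space (centered_normal \<sigma>) = UNIV"
  and sets_centered_normal [simp, measurable_cong]: "sets (centered_normal \<sigma>) = sets borel"
  by (simp_all add: centered_normal_def)

lemma prob_space_centered_normal: "0 < \<sigma> \<Longrightarrow> prob_space (centered_normal \<sigma>)"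
  unfolding centered_normal_def by (rule prob_space_normal_density)

lemma nn_integral_centered_normal:
  "f \<in> borel_measurable borel \<Longrightarrow>
    (\<integral>\<^sup>+z. f z \<partial>centered_normal \<sigma>) = (\<integral>\<^sup>+z. ennreal (normal_density 0 \<sigma> z) * f z \<partial>lborel)"
  unfolding centered_normal_def by (subst nn_integral_density) auto

text \<open>
  Symmetry of the step distribution turns the integral of a function into that of its even part, to
  which the comparison with \<open>cosh\<close> applies.
\<close>

lemma nn_integral_centered_normal_reflect:
  assumes [measurable]: "f \<in> borel_measurable borel"
  shows "(\<integral>\<^sup>+z. f (- z) \<partial>centered_normal \<sigma>) = (\<integral>\<^sup>+z. f z \<partial>centered_normal \<sigma>)"
proof -
  have "(\<integral>\<^sup>+z. f z \<partial>centered_normal \<sigma>) = (\<integral>\<^sup>+z. ennreal (normal_density 0 \<sigma> (- z)) * f (- z) \<partial>lborel)"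
    using nn_integral_real_affine[of "\<lambda>z. ennreal (normal_density 0 \<sigma> z) * f z" "-1" 0]
    by (simp add: nn_integral_centered_normal)
  then show ?thesis
    by (simp add: nn_integral_centered_normal normal_density_def)
qed

text \<open>
  Exponential tilting of a centred normal density is a shift of its mean.
\<close>

lemma has_integral_normal_cosh:
  assumes "0 < \<sigma>"
  shows "has_bochner_integral lborel (\<lambda>z. normal_density 0 \<sigma> z * cosh (2 * z)) (exp (2 * \<sigma>\<^sup>2))"
proof -
  have tilt: "normal_density 0 \<sigma> z * exp (c * z) = exp (c\<^sup>2 * \<sigma>\<^sup>2 / 2) * normal_density (c * \<sigma>\<^sup>2) \<sigma> z" for c z
  proof -
    have "- z\<^sup>2 / (2 * \<sigma>\<^sup>2) + c * z = c\<^sup>2 * \<sigma>\<^sup>2 / 2 + - (z - c * \<sigma>\<^sup>2)\<^sup>2 / (2 * \<sigma>\<^sup>2)"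
      using assms by (simp add: field_simps power2_eq_square)
    then have "exp (- z\<^sup>2 / (2 * \<sigma>\<^sup>2)) * exp (c * z)
        = exp (c\<^sup>2 * \<sigma>\<^sup>2 / 2) * exp (- (z - c * \<sigma>\<^sup>2)\<^sup>2 / (2 * \<sigma>\<^sup>2))"
      by (simp only: exp_add[symmetric])
    then show ?thesis by (simp add: normal_density_def)
  qed
  have "has_bochner_integral lborel
      (\<lambda>z. exp (2 * \<sigma>\<^sup>2) / 2 * normal_density (2 * \<sigma>\<^sup>2) \<sigma> z + exp (2 * \<sigma>\<^sup>2) / 2 * normal_density (- 2 * \<sigma>\<^sup>2) \<sigma> z)
      (exp (2 * \<sigma>\<^sup>2) / 2 * 1 + exp (2 * \<sigma>\<^sup>2) / 2 * 1)"
    using assms integrable_normal_density[OF assms] integral_normal_density[OF assms]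
    by (intro has_bochner_integral_add has_bochner_integral_mult_right)
      (auto simp: has_bochner_integral_iff)
  moreover have "normal_density 0 \<sigma> z * cosh (2 * z) =
      exp (2 * \<sigma>\<^sup>2) / 2 * normal_density (2 * \<sigma>\<^sup>2) \<sigma> z + exp (2 * \<sigma>\<^sup>2) / 2 * normal_density (- 2 * \<sigma>\<^sup>2) \<sigma> z" for z
    using tilt[of z 2] tilt[of z "-2"] by (simp add: cosh_def field_simps)
  ultimately show ?thesis by simp
qed

lemma borel_measurable_excess [measurable]: "excess \<in> borel_measurable borel"
  by (rule borel_measurable_continuous_onI[OF excess_continuous])

lemma borel_measurable_cosh [measurable]: "(cosh :: real \<Rightarrow> real) \<in> borel_measurable borel"
  by (intro borel_measurable_continuous_onI continuous_intros)

lemma borel_measurable_range_value [measurable (raw)]: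
  assumes [measurable]: "f \<in> borel_measurable M" "g \<in> borel_measurable M" "h \<in> borel_measurable M"
  shows "(\<lambda>x. range_value (f x) (g x) (h x)) \<in> borel_measurable M"
  unfolding range_value_def by measurable

text \<open>
  One step of the walk. The killing rate matches the step variance: a step of variance \<open>\<sigma>\<^sup>2\<close>
  survives with probability \<open>exp (- 2 \<sigma>\<^sup>2)\<close>, which is the reciprocal of the mean of \<open>cosh (2 z)\<close>.
\<close>

lemma range_value_normal_step:
  assumes \<sigma>: "0 < \<sigma>" and y: "a \<le> y" "y \<le> b"
  shows "(\<integral>\<^sup>+z. ennreal (range_value (y + z) (min a (y + z)) (max b (y + z))) \<partial>centered_normal \<sigma>)
      + ennreal ((exp (2 * \<sigma>\<^sup>2) - 1) * (b - a)\<^sup>2)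
    \<le> ennreal (exp (2 * \<sigma>\<^sup>2)) * ennreal (range_value y a b)"
proof -
  define v where "v z = range_value (y + z) (min a (y + z)) (max b (y + z))" for z
  define u where "u z = cosh (2 * z) * range_value y a b - (cosh (2 * z) - 1) * (b - a)\<^sup>2" for z
  let ?E = "exp (2 * \<sigma>\<^sup>2)"
  have ab: "a \<le> b" using y by simp
  have v_nonneg: "0 \<le> v z" for z
    unfolding v_def using ab by (intro range_value_nonneg) auto
  have [measurable]: "v \<in> borel_measurable borel" "u \<in> borel_measurable borel"
    unfolding v_def u_def by measurable
  have vu: "v z + v (- z) \<le> 2 * u z" for z
    using symmetric_range_value_step[OF ab, of y z] y by (simp add: v_def u_def algebra_simps)
  have u_nonneg: "0 \<le> u z" for z
    using vu[of z] v_nonneg[of z] v_nonneg[of "- z"] by simp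
  have "2 * (\<integral>\<^sup>+z. v z \<partial>centered_normal \<sigma>) = (\<integral>\<^sup>+z. v z \<partial>centered_normal \<sigma>) + (\<integral>\<^sup>+z. v (- z) \<partial>centered_normal \<sigma>)"
    using nn_integral_centered_normal_reflect[of "\<lambda>z. ennreal (v z)" \<sigma>] by (simp add: mult_2)
  also have "\<dots> = (\<integral>\<^sup>+z. ennreal (v z + v (- z)) \<partial>centered_normal \<sigma>)"
    by (subst nn_integral_add[symmetric]) (auto simp: ennreal_plus[OF v_nonneg v_nonneg] simp del: ennreal_plus)
  also have "\<dots> \<le> (\<integral>\<^sup>+z. ennreal (2 * u z) \<partial>centered_normal \<sigma>)"
    using vu by (intro nn_integral_mono ennreal_leI)
  also have "\<dots> = 2 * (\<integral>\<^sup>+z. u z \<partial>centered_normal \<sigma>)"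
    by (simp add: ennreal_mult' nn_integral_cmult)
  finally have "(\<integral>\<^sup>+z. v z \<partial>centered_normal \<sigma>) \<le> (\<integral>\<^sup>+z. u z \<partial>centered_normal \<sigma>)"
    by (simp add: ennreal_mult_le_mult_iff)
  also have "\<dots> = (\<integral>\<^sup>+z. ennreal (normal_density 0 \<sigma> z * u z) \<partial>lborel)"
    by (simp add: nn_integral_centered_normal ennreal_mult'' u_nonneg)
  also have "\<dots> = ennreal (?E * range_value y a b - (?E - 1) * (b - a)\<^sup>2)"
  proof (rule nn_integral_eq_integral[THEN trans])
    have "has_bochner_integral lborel
        (\<lambda>z. (normal_density 0 \<sigma> z * cosh (2 * z)) * (range_value y a b - (b - a)\<^sup>2)
           + normal_density 0 \<sigma> z * (b - a)\<^sup>2)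
        (?E * (range_value y a b - (b - a)\<^sup>2) + 1 * (b - a)\<^sup>2)"
      using integrable_normal_density[OF \<sigma>] integral_normal_density[OF \<sigma>]
      by (intro has_bochner_integral_add has_bochner_integral_mult_left has_integral_normal_cosh[OF \<sigma>])
        (auto simp: has_bochner_integral_iff)
    moreover have "(\<lambda>z. (normal_density 0 \<sigma> z * cosh (2 * z)) * (range_value y a b - (b - a)\<^sup>2)
           + normal_density 0 \<sigma> z * (b - a)\<^sup>2) = (\<lambda>z. normal_density 0 \<sigma> z * u z)"
      by (simp add: u_def algebra_simps)
    ultimately have int: "has_bochner_integral lborel (\<lambda>z. normal_density 0 \<sigma> z * u z)
        (?E * range_value y a b - (?E - 1) * (b - a)\<^sup>2)"
      by (simp add: algebra_simps)
    then show "integrable lborel (\<lambda>z. normal_density 0 \<sigma> z * u z)"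
      by (rule integrable.intros)
    show "ennreal (\<integral>z. normal_density 0 \<sigma> z * u z \<partial>lborel) =
        ennreal (?E * range_value y a b - (?E - 1) * (b - a)\<^sup>2)"
      using int by (simp add: has_bochner_integral_integral_eq)
    show "AE z in lborel. 0 \<le> normal_density 0 \<sigma> z * u z"
      using u_nonneg by simp
  qed
  finally have le: "(\<integral>\<^sup>+z. v z \<partial>centered_normal \<sigma>) \<le> ennreal (?E * range_value y a b - (?E - 1) * (b - a)\<^sup>2)" .
  have "(b - a)\<^sup>2 \<le> range_value y a b"
    using excess_nonneg[of "b - a"] ab by (simp add: range_value_def)
  then have "(?E - 1) * (b - a)\<^sup>2 \<le> ?E * range_value y a b"
    by (intro mult_mono) auto
  moreover have "0 \<le> (?E - 1) * (b - a)\<^sup>2" by simp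
  ultimately have "ennreal (?E * range_value y a b - (?E - 1) * (b - a)\<^sup>2) + ennreal ((?E - 1) * (b - a)\<^sup>2)
      = ennreal (?E * range_value y a b)"
    by (subst ennreal_plus[symmetric]) auto
  then show ?thesis
    using add_right_mono[OF le, of "ennreal ((?E - 1) * (b - a)\<^sup>2)"]
    by (simp add: v_def ennreal_mult')
qed

lemma nn_integral_PiM_Suc:
  assumes "prob_space N" and f: "f \<in> borel_measurable (PiM {..<Suc k} (\<lambda>_. N))"
  shows "(\<integral>\<^sup>+d. f d \<partial>PiM {..<Suc k} (\<lambda>_. N)) = (\<integral>\<^sup>+d. \<integral>\<^sup>+z. f (d(k := z)) \<partial>N \<partial>PiM {..<k} (\<lambda>_. N))"
proof -
  interpret N: prob_space N by fact
  interpret product_sigma_finite "\<lambda>_. N" by standard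
  show ?thesis
    using product_nn_integral_insert[of "{..<k}" k f] f by (simp add: lessThan_Suc)
qed

primrec walk_max :: "(nat \<Rightarrow> real) \<Rightarrow> nat \<Rightarrow> real" where
  "walk_max d 0 = 0"
| "walk_max d (Suc k) = max (walk_max d k) (\<Sum>l<Suc k. d l)"

primrec walk_min :: "(nat \<Rightarrow> real) \<Rightarrow> nat \<Rightarrow> real" where
  "walk_min d 0 = 0"
| "walk_min d (Suc k) = min (walk_min d k) (\<Sum>l<Suc k. d l)"

definition walk_range :: "(nat \<Rightarrow> real) \<Rightarrow> nat \<Rightarrow> real" where
  "walk_range d k = walk_max d k - walk_min d k"

lemma walk_between: "j \<le> k \<Longrightarrow> walk_min d k \<le> (\<Sum>l<j. d l) \<and> (\<Sum>l<j. d l) \<le> walk_max d k"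
proof (induction k)
  case (Suc k)
  then show ?case
    by (cases "j = Suc k") (auto simp del: sum.lessThan_Suc simp: le_Suc_eq min.coboundedI1 max.coboundedI1)
qed simp

lemma walk_cong:
  assumes "\<And>l. l < k \<Longrightarrow> d l = d' l"
  shows "walk_max d k = walk_max d' k" "walk_min d k = walk_min d' k"
proof -
  have "walk_max d j = walk_max d' j \<and> walk_min d j = walk_min d' j" if "j \<le> k" for j
    using that
  proof (induction j)
    case (Suc j)
    have "(\<Sum>l<Suc j. d l) = (\<Sum>l<Suc j. d' l)"
      using assms Suc.prems by (intro sum.cong) auto
    with Suc show ?case by simp
  qed simp
  then show "walk_max d k = walk_max d' k" "walk_min d k = walk_min d' k" by auto
qed

lemma walk_scale:
  assumes "0 \<le> c"
  shows "walk_max (\<lambda>l. c * d l) k = c * walk_max d k" "walk_min (\<lambda>l. c * d l) k = c * walk_min d k"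
  by (induction k)
    (auto simp: sum_distrib_left[symmetric] max_mult_distrib_left min_mult_distrib_left assms
       distrib_left[symmetric] simp del: sum.lessThan_Suc)

lemma borel_measurable_partial_sum:
  fixes N :: "real measure" and k n :: nat
  assumes N: "sets N = sets borel" and "k \<le> n"
  shows "(\<lambda>d. \<Sum>l<k. d l) \<in> borel_measurable (PiM {..<n} (\<lambda>_. N))"
proof (rule borel_measurable_sum)
  fix l assume "l \<in> {..<k}"
  then have "(\<lambda>d. d l) \<in> measurable (PiM {..<n} (\<lambda>_. N)) N"
    using assms(2) by (intro measurable_component_singleton) auto
  then show "(\<lambda>d. d l) \<in> borel_measurable (PiM {..<n} (\<lambda>_. N))"
    by (simp only: measurable_cong_sets[OF refl N])
qed

lemma borel_measurable_walk:
  fixes N :: "real measure" and k n :: nat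
  assumes N: "sets N = sets borel" and "k \<le> n"
  shows "(\<lambda>d. walk_max d k) \<in> borel_measurable (PiM {..<n} (\<lambda>_. N))"
    "(\<lambda>d. walk_min d k) \<in> borel_measurable (PiM {..<n} (\<lambda>_. N))"
proof -
  have "(\<lambda>d. walk_max d k) \<in> borel_measurable (PiM {..<n} (\<lambda>_. N)) \<and>
      (\<lambda>d. walk_min d k) \<in> borel_measurable (PiM {..<n} (\<lambda>_. N))"
    using assms(2)
  proof (induction k)
    case (Suc k)
    then show ?case
      using borel_measurable_partial_sum[OF N, of "Suc k" n]
      by (auto simp del: sum.lessThan_Suc intro!: borel_measurable_max borel_measurable_min)
  qed simp
  then show "(\<lambda>d. walk_max d k) \<in> borel_measurable (PiM {..<n} (\<lambda>_. N))"
    "(\<lambda>d. walk_min d k) \<in> borel_measurable (PiM {..<n} (\<lambda>_. N))" by auto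
qed

definition mean_sq_range :: "real \<Rightarrow> nat \<Rightarrow> ennreal" where
  "mean_sq_range \<sigma> k = (\<integral>\<^sup>+d. ennreal ((walk_range d k)\<^sup>2) \<partial>PiM {..<k} (\<lambda>_. centered_normal \<sigma>))"

text \<open>
  The pointwise step inequality, integrated over the past of the walk. All quantities are extended
  nonnegative reals, so no integrability has to be checked.
\<close>

lemma range_value_walk_step:
  fixes \<sigma> :: real
  defines "E \<equiv> exp (2 * \<sigma>\<^sup>2)"
  defines "v \<equiv> \<lambda>k. \<integral>\<^sup>+d. ennreal (range_value (\<Sum>l<k. d l) (walk_min d k) (walk_max d k))
    \<partial>PiM {..<k} (\<lambda>_. centered_normal \<sigma>)"
  assumes \<sigma>: "0 < \<sigma>"
  shows "v (Suc k) + ennreal (E - 1) * mean_sq_range \<sigma> k \<le> ennreal E * v k"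
proof -
  let ?P = "\<lambda>k. PiM {..<k} (\<lambda>_. centered_normal \<sigma>)"
  have E: "1 \<le> E" by (simp add: E_def)
  have [measurable]: "(\<lambda>d. walk_max d j) \<in> borel_measurable (?P j)"
    "(\<lambda>d. walk_min d j) \<in> borel_measurable (?P j)"
    "(\<lambda>d. \<Sum>l<j. d l) \<in> borel_measurable (?P j)" for j
    by (simp_all add: borel_measurable_walk borel_measurable_partial_sum)
  have cong: "walk_max (d(k := z)) k = walk_max d k" "walk_min (d(k := z)) k = walk_min d k"
    "(\<Sum>l<k. (d(k := z)) l) = (\<Sum>l<k. d l)" for d :: "nat \<Rightarrow> real" and z
    by (rule walk_cong, simp)+ (auto intro!: sum.cong)
  have "v (Suc k) = (\<integral>\<^sup>+d. \<integral>\<^sup>+z. ennreal (range_value ((\<Sum>l<k. d l) + z)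
        (min (walk_min d k) ((\<Sum>l<k. d l) + z)) (max (walk_max d k) ((\<Sum>l<k. d l) + z)))
        \<partial>centered_normal \<sigma> \<partial>?P k)"
    unfolding v_def
    by (subst nn_integral_PiM_Suc[OF prob_space_centered_normal[OF \<sigma>]]) (measurable, simp add: cong)
  moreover have "ennreal (E - 1) * mean_sq_range \<sigma> k = (\<integral>\<^sup>+d. ennreal ((E - 1) * (walk_range d k)\<^sup>2) \<partial>?P k)"
    unfolding mean_sq_range_def walk_range_def using E
    by (subst nn_integral_cmult[symmetric]) (auto simp: ennreal_mult')
  ultimately have "v (Suc k) + ennreal (E - 1) * mean_sq_range \<sigma> k =
      (\<integral>\<^sup>+d. (\<integral>\<^sup>+z. ennreal (range_value ((\<Sum>l<k. d l) + z)
        (min (walk_min d k) ((\<Sum>l<k. d l) + z)) (max (walk_max d k) ((\<Sum>l<k. d l) + z)))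
        \<partial>centered_normal \<sigma>) + ennreal ((E - 1) * (walk_max d k - walk_min d k)\<^sup>2) \<partial>?P k)"
    unfolding walk_range_def
  proof (simp, subst nn_integral_add)
    interpret prob_space "centered_normal \<sigma>" by (rule prob_space_centered_normal[OF \<sigma>])
    show "(\<lambda>d. \<integral>\<^sup>+z. ennreal (range_value ((\<Sum>l<k. d l) + z)
        (min (walk_min d k) ((\<Sum>l<k. d l) + z)) (max (walk_max d k) ((\<Sum>l<k. d l) + z)))
        \<partial>centered_normal \<sigma>) \<in> borel_measurable (?P k)"
      by measurable
  qed auto
  also have "\<dots> \<le> (\<integral>\<^sup>+d. ennreal E * ennreal (range_value (\<Sum>l<k. d l) (walk_min d k) (walk_max d k)) \<partial>?P k)"
    unfolding E_def by (intro nn_integral_mono range_value_normal_step \<sigma>) (use walk_between in auto)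
  also have "\<dots> = ennreal E * v k"
    unfolding v_def by (rule nn_integral_cmult) measurable
  finally show ?thesis .
qed

text \<open>
  The expected squared range of the walk at a geometric time is bounded by the initial value
  \<open>2 ln 2\<close>: the weighted values decrease in mean by at least the summands.
\<close>

lemma geometric_mean_sq_range_le:
  assumes \<sigma>: "0 < \<sigma>" and q: "q = exp (- 2 * \<sigma>\<^sup>2)"
  shows "(\<Sum>j<k. ennreal ((1 - q) * q ^ j) * mean_sq_range \<sigma> j) \<le> ennreal (2 * ln 2)"
proof -
  define v where "v k = (\<integral>\<^sup>+d. ennreal (range_value (\<Sum>l<k. d l) (walk_min d k) (walk_max d k))
    \<partial>PiM {..<k} (\<lambda>_. centered_normal \<sigma>))" for k :: nat
  have q01: "0 < q" "q \<le> 1" by (simp_all add: q)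
  have E: "q * exp (2 * \<sigma>\<^sup>2) = 1" by (simp add: q exp_minus)
  have "(\<Sum>j<k. ennreal ((1 - q) * q ^ j) * mean_sq_range \<sigma> j) + ennreal (q ^ k) * v k \<le> v 0"
  proof (induction k)
    case 0
    then show ?case by simp
  next
    case (Suc k)
    have "ennreal (q ^ Suc k) * v (Suc k) + ennreal ((1 - q) * q ^ k) * mean_sq_range \<sigma> k
        = ennreal (q ^ Suc k) * (v (Suc k) + ennreal (exp (2 * \<sigma>\<^sup>2) - 1) * mean_sq_range \<sigma> k)"
    proof -
      have "(1 - q) * q ^ k = q ^ Suc k * (exp (2 * \<sigma>\<^sup>2) - 1)"
        using E by (simp add: algebra_simps)
      moreover have "ennreal (q ^ Suc k * (exp (2 * \<sigma>\<^sup>2) - 1)) = ennreal (q ^ Suc k) * ennreal (exp (2 * \<sigma>\<^sup>2) - 1)"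
        using q01 by (intro ennreal_mult) auto
      ultimately show ?thesis by (simp only: distrib_left mult.assoc)
    qed
    also have "\<dots> \<le> ennreal (q ^ Suc k) * (ennreal (exp (2 * \<sigma>\<^sup>2)) * v k)"
      using range_value_walk_step[OF \<sigma>, of k] unfolding v_def by (intro mult_left_mono) auto
    also have "\<dots> = ennreal (q ^ k) * v k"
    proof -
      have "ennreal (q ^ Suc k) * ennreal (exp (2 * \<sigma>\<^sup>2)) = ennreal (q ^ Suc k * exp (2 * \<sigma>\<^sup>2))"
        using q01 by (intro ennreal_mult[symmetric]) auto
      also have "q ^ Suc k * exp (2 * \<sigma>\<^sup>2) = q ^ k" using E by (simp add: algebra_simps)
      finally show ?thesis by (simp add: mult.assoc[symmetric])
    qed
    finally have "ennreal (q ^ Suc k) * v (Suc k) + ennreal ((1 - q) * q ^ k) * mean_sq_range \<sigma> k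
      \<le> ennreal (q ^ k) * v k" .
    then have "(\<Sum>j<k. ennreal ((1 - q) * q ^ j) * mean_sq_range \<sigma> j) +
       (ennreal (q ^ Suc k) * v (Suc k) + ennreal ((1 - q) * q ^ k) * mean_sq_range \<sigma> k) \<le> v 0"
      using Suc.IH by (meson add_left_mono order_trans)
    then show ?case by (simp only: sum.lessThan_Suc ac_simps)
  qed
  moreover have "v 0 = ennreal (2 * ln 2)"
  proof -
    interpret prob_space "PiM {..<0::nat} (\<lambda>_. centered_normal \<sigma>)"
      by (rule prob_space_PiM[OF prob_space_centered_normal[OF \<sigma>]])
    show ?thesis unfolding v_def using emeasure_space_1 by (simp add: range_value_0)
  qed
  ultimately show ?thesis
    by (metis add_increasing2 order_trans order_refl zero_le le_iff_add)
qed

lemma centered_normal_scale: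
  assumes "0 < c" "0 < \<sigma>"
  shows "distr (centered_normal \<sigma>) borel (\<lambda>z. c * z) = centered_normal (c * \<sigma>)"
proof -
  interpret prob_space "centered_normal \<sigma>" by (rule prob_space_centered_normal[OF assms(2)])
  have "distributed (centered_normal \<sigma>) lborel (\<lambda>z. z) (normal_density 0 \<sigma>)"
    unfolding distributed_def using distr_id2[of lborel "centered_normal \<sigma>"]
    by (auto simp: centered_normal_def id_def)
  from normal_density_affine[OF this assms(2), of c 0] assms
  have "distributed (centered_normal \<sigma>) lborel (\<lambda>z. c * z) (normal_density 0 (c * \<sigma>))"
    by simp
  then have "distr (centered_normal \<sigma>) lborel (\<lambda>z. c * z) = centered_normal (c * \<sigma>)"
    unfolding distributed_def centered_normal_def by simp
  moreover have "distr (centered_normal \<sigma>) lborel (\<lambda>z. c * z) = distr (centered_normal \<sigma>) borel (\<lambda>z. c * z)"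
    by (rule distr_cong) auto
  ultimately show ?thesis by simp
qed

lemma mean_sq_range_scale:
  assumes "0 < c" "0 < \<sigma>"
  shows "mean_sq_range (c * \<sigma>) k = ennreal (c\<^sup>2) * mean_sq_range \<sigma> k"
proof -
  let ?P = "\<lambda>\<sigma>. PiM {..<k} (\<lambda>_. centered_normal \<sigma>)"
  have c\<sigma>: "0 < c * \<sigma>" using assms by simp
  have [measurable]: "(\<lambda>d. walk_range d k) \<in> borel_measurable (?P \<sigma>)" for \<sigma>
    unfolding walk_range_def by (intro borel_measurable_diff borel_measurable_walk) auto
  have [measurable]: "compose {..<k} (\<lambda>z. c * z) \<in> measurable (?P \<sigma>) (?P (c * \<sigma>))"
    unfolding compose_def by measurable
  have "?P (c * \<sigma>) = distr (?P \<sigma>) (?P (c * \<sigma>)) (compose {..<k} (\<lambda>z. c * z))"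
  proof (subst distr_PiM_finite_prob_space')
    have "distr (centered_normal \<sigma>) (centered_normal (c * \<sigma>)) (\<lambda>z. c * z)
        = distr (centered_normal \<sigma>) borel (\<lambda>z. c * z)"
      by (rule distr_cong) auto
    then show "?P (c * \<sigma>) = PiM {..<k} (\<lambda>i. distr (centered_normal \<sigma>) (centered_normal (c * \<sigma>)) (\<lambda>z. c * z))"
      by (simp add: centered_normal_scale assms)
  qed (use prob_space_centered_normal assms c\<sigma> in \<open>auto simp: measurable_cong_sets[OF sets_centered_normal sets_centered_normal]\<close>)
  then have "mean_sq_range (c * \<sigma>) k =
      (\<integral>\<^sup>+d. ennreal ((walk_range d k)\<^sup>2) \<partial>distr (?P \<sigma>) (?P (c * \<sigma>)) (compose {..<k} (\<lambda>z. c * z)))"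
    by (simp add: mean_sq_range_def)
  also have "\<dots> = (\<integral>\<^sup>+d. ennreal ((walk_range (compose {..<k} (\<lambda>z. c * z) d) k)\<^sup>2) \<partial>?P \<sigma>)"
    by (subst nn_integral_distr) auto
  also have "\<dots> = (\<integral>\<^sup>+d. ennreal (c\<^sup>2) * ennreal ((walk_range d k)\<^sup>2) \<partial>?P \<sigma>)"
  proof (rule nn_integral_cong)
    fix d
    have "walk_range (compose {..<k} (\<lambda>z. c * z) d) k = walk_range (\<lambda>l. c * d l) k"
      unfolding walk_range_def by (intro arg_cong2[where f = minus] walk_cong) (auto simp: compose_def)
    also have "\<dots> = c * walk_range d k"
      using assms(1) by (simp add: walk_range_def walk_scale right_diff_distrib)
    finally show "ennreal ((walk_range (compose {..<k} (\<lambda>z. c * z) d) k)\<^sup>2) = ennreal (c\<^sup>2) * ennreal ((walk_range d k)\<^sup>2)"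
      by (simp add: power_mult_distrib ennreal_mult')
  qed
  also have "\<dots> = ennreal (c\<^sup>2) * mean_sq_range \<sigma> k"
    unfolding mean_sq_range_def by (rule nn_integral_cmult) measurable
  finally show ?thesis .
qed

text \<open>
  By scaling, a walk of \<open>j\<close> steps of variance \<open>h\<close> has \<open>h j\<close> times the mean squared range of a walk
  of \<open>j\<close> steps of variance \<open>1 / j\<close>. As \<open>h\<close> tends to \<open>0\<close> the geometric time becomes large, the first
  \<open>J\<close> terms are negligible, and \<open>h\<close> times the mean of the geometric time tends to \<open>1 / 2\<close>.
\<close>

lemma eventual_bound_mean_sq_range:
  assumes c: "0 \<le> c" and J: "0 < J"
    and le: "\<And>j. J \<le> j \<Longrightarrow> ennreal c \<le> mean_sq_range (sqrt (1 / real j)) j"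
  shows "c \<le> 4 * ln 2"
proof -
  have bound: "c * (h * (exp (- 2 * h) / (1 - exp (- 2 * h)) - real (J * J))) \<le> 2 * ln 2" if h: "0 < h" for h
  proof -
    define q where "q = exp (- 2 * h)"
    have q: "0 < q" "q < 1" using h by (simp_all add: q_def)
    \<comment> \<open>Subtracting J * J is a crude allowance for the terms below J, for which no bound is assumed.\<close>
    have partial: "c * (h * ((1 - q) * (\<Sum>j<k. real j * q ^ j) - real (J * J))) \<le> 2 * ln 2" for k
    proof -
      have nonneg: "0 \<le> (1 - q) * q ^ j * (h * real j * c)" for j
        using q h c by simp
      have "ennreal (\<Sum>j\<in>{J..<k}. (1 - q) * q ^ j * (h * real j * c))
          = (\<Sum>j\<in>{J..<k}. ennreal ((1 - q) * q ^ j * (h * real j * c)))"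
        by (rule sum_ennreal[symmetric]) (rule nonneg)
      also have "\<dots> \<le> (\<Sum>j\<in>{J..<k}. ennreal ((1 - q) * q ^ j) * mean_sq_range (sqrt h) j)"
      proof (rule sum_mono)
        fix j assume j: "j \<in> {J..<k}"
        then have j0: "0 < real j" using J by simp
        have "sqrt h = sqrt (h * real j) * sqrt (1 / real j)"
          using j0 by (simp add: real_sqrt_mult real_sqrt_divide)
        then have "mean_sq_range (sqrt h) j = ennreal (h * real j) * mean_sq_range (sqrt (1 / real j)) j"
          using mean_sq_range_scale[of "sqrt (h * real j)" "sqrt (1 / real j)" j] j0 h by simp
        moreover have "ennreal (h * real j * c) \<le> ennreal (h * real j) * mean_sq_range (sqrt (1 / real j)) j"
          using le[of j] j h c by (subst ennreal_mult) (auto intro!: mult_left_mono)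
        ultimately have "ennreal ((1 - q) * q ^ j) * ennreal (h * real j * c)
            \<le> ennreal ((1 - q) * q ^ j) * mean_sq_range (sqrt h) j"
          by (intro mult_left_mono) auto
        then show "ennreal ((1 - q) * q ^ j * (h * real j * c)) \<le> ennreal ((1 - q) * q ^ j) * mean_sq_range (sqrt h) j"
          using q h c by (subst ennreal_mult) auto
      qed
      also have "\<dots> \<le> (\<Sum>j<k. ennreal ((1 - q) * q ^ j) * mean_sq_range (sqrt h) j)"
        by (rule sum_mono2) auto
      also have "\<dots> \<le> ennreal (2 * ln 2)"
        using h by (intro geometric_mean_sq_range_le) (auto simp: q_def)
      finally have "(\<Sum>j\<in>{J..<k}. (1 - q) * q ^ j * (h * real j * c)) \<le> 2 * ln 2"
        by (subst (asm) ennreal_le_iff) auto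
      moreover have "c * (h * ((1 - q) * (\<Sum>j\<in>{J..<k}. real j * q ^ j)))
          = (\<Sum>j\<in>{J..<k}. (1 - q) * q ^ j * (h * real j * c))"
        by (simp add: sum_distrib_left mult_ac)
      moreover have "(1 - q) * (\<Sum>j<k. real j * q ^ j) - real (J * J) \<le> (1 - q) * (\<Sum>j\<in>{J..<k}. real j * q ^ j)"
      proof -
        have "(\<Sum>j<k. real j * q ^ j) \<le> (\<Sum>j\<in>{..<J} \<union> {J..<k}. real j * q ^ j)"
          using q by (intro sum_mono2) auto
        also have "\<dots> = (\<Sum>j<J. real j * q ^ j) + (\<Sum>j\<in>{J..<k}. real j * q ^ j)"
          by (rule sum.union_disjoint) auto
        also have "(\<Sum>j<J. real j * q ^ j) \<le> (\<Sum>j<J. real J * 1)"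
          using q by (intro sum_mono mult_mono) (auto intro: power_le_one)
        finally have "(1 - q) * (\<Sum>j<k. real j * q ^ j) \<le> (1 - q) * (real (J * J) + (\<Sum>j\<in>{J..<k}. real j * q ^ j))"
          using q by (intro mult_left_mono) auto
        moreover have "(1 - q) * real (J * J) \<le> 1 * real (J * J)"
          using q by (intro mult_right_mono) auto
        ultimately show ?thesis by (simp add: distrib_left)
      qed
      ultimately show ?thesis
        using c h by (smt (verit) mult_left_mono)
    qed
    have "(\<lambda>j. real (Suc j) * q ^ Suc j) sums (q / (1 - q)\<^sup>2)"
      using sums_mult[OF geometric_deriv_sums[of q], of q] q by (simp add: mult_ac)
    then have "(\<lambda>j. real j * q ^ j) sums (q / (1 - q)\<^sup>2)"
      by (subst (asm) sums_Suc_iff) simp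
    then have "(\<lambda>k. c * (h * ((1 - q) * (\<Sum>j<k. real j * q ^ j) - real (J * J))))
        \<longlonglongrightarrow> c * (h * ((1 - q) * (q / (1 - q)\<^sup>2) - real (J * J)))"
      unfolding sums_def by (intro tendsto_intros)
    then have "c * (h * ((1 - q) * (q / (1 - q)\<^sup>2) - real (J * J))) \<le> 2 * ln 2"
      using partial by (intro LIMSEQ_le_const2[of _ _ "2 * ln 2"]) auto
    moreover have "(1 - q) * (q / (1 - q)\<^sup>2) = q / (1 - q)"
      using q by (simp add: power2_eq_square)
    ultimately show ?thesis by (simp only: q_def)
  qed
  have "((\<lambda>h::real. c * (h * (exp (- 2 * h) / (1 - exp (- 2 * h)) - real (J * J)))) \<longlongrightarrow> c * (1 / 2)) (at_right 0)"
    by (intro tendsto_mult tendsto_const) real_asymp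
  moreover have "\<forall>\<^sub>F h in at_right 0. c * (h * (exp (- 2 * h) / (1 - exp (- 2 * h)) - real (J * J))) \<le> 2 * ln 2"
    by (rule eventually_mono[OF eventually_at_right_less[of 0] bound])
  ultimately have "c * (1 / 2) \<le> 2 * ln 2"
    by (rule tendsto_upperbound) simp
  then show ?thesis by simp
qed

lemma liminf_mean_sq_range_le:
  "liminf (\<lambda>j. mean_sq_range (sqrt (1 / real j)) j) \<le> ennreal (4 * ln 2)"
proof (rule ccontr)
  assume "\<not> ?thesis"
  then obtain c where c: "ennreal (4 * ln 2) < c" "c < liminf (\<lambda>j. mean_sq_range (sqrt (1 / real j)) j)"
    using dense by (auto simp: not_le)
  then have "c \<noteq> top" by (metis not_less_iff_gr_or_eq top_greatest not_le)
  then obtain r where r: "0 \<le> r" "c = ennreal r" by (cases c) auto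
  have "\<forall>\<^sub>F j in sequentially. c < mean_sq_range (sqrt (1 / real j)) j"
    using c(2) by (rule less_LiminfD)
  then obtain J where J: "\<And>j. J \<le> j \<Longrightarrow> c < mean_sq_range (sqrt (1 / real j)) j"
    by (auto simp: eventually_sequentially)
  have "r \<le> 4 * ln 2"
    using J r by (intro eventual_bound_mean_sq_range[of r "Suc J"]) (auto simp: less_imp_le)
  then show False using c(1) r by (simp add: ennreal_less_iff)
qed

section \<open>Exit of a Gaussian random walk from a ball\<close>

definition sq_norm :: "('n::finite \<Rightarrow> real) \<Rightarrow> real" where
  "sq_norm v = (\<Sum>i\<in>UNIV. (v i)\<^sup>2)"

lemma sq_norm_nonneg: "0 \<le> sq_norm v"
  unfolding sq_norm_def by (intro sum_nonneg) auto

lemma sq_norm_add: "sq_norm (\<lambda>i. x i + z i) = sq_norm x + 2 * (\<Sum>i\<in>UNIV. x i * z i) + sq_norm z"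
  unfolding sq_norm_def by (simp add: power2_sum sum.distrib sum_distrib_left mult.assoc algebra_simps)

lemma sq_norm_triangle: "sqrt (sq_norm (\<lambda>i. x i + z i)) \<le> sqrt (sq_norm x) + sqrt (sq_norm z)"
  using L2_set_triangle_ineq[of x z UNIV] by (simp add: L2_set_def sq_norm_def)

lemma sq_norm_square_le: "(sq_norm (v :: 'n::finite \<Rightarrow> real))\<^sup>2 \<le> real CARD('n) * (\<Sum>i\<in>UNIV. (v i) ^ 4)"
proof -
  have "(\<Sum>i\<in>UNIV. 1 * (v i)\<^sup>2)\<^sup>2 \<le> (\<Sum>i\<in>(UNIV::'n set). 1\<^sup>2) * (\<Sum>i\<in>UNIV. ((v i)\<^sup>2)\<^sup>2)"
    by (rule Cauchy_Schwarz_ineq_sum)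
  then show ?thesis by (simp add: sq_norm_def)
qed

definition normal_vector :: "real \<Rightarrow> ('n::finite \<Rightarrow> real) measure" where
  "normal_vector \<sigma> = PiM UNIV (\<lambda>_. centered_normal \<sigma>)"

lemma space_normal_vector [simp]: "space (normal_vector \<sigma>) = UNIV"
  by (simp add: normal_vector_def space_PiM)

lemma sets_normal_vector [measurable_cong]: "sets (normal_vector \<sigma>) = sets (PiM UNIV (\<lambda>_. borel))"
  unfolding normal_vector_def by (rule sets_PiM_cong) auto

lemma prob_space_normal_vector: "0 < \<sigma> \<Longrightarrow> prob_space (normal_vector \<sigma>)"
  unfolding normal_vector_def by (intro prob_space_PiM prob_space_centered_normal)

lemma sq_norm_measurable [measurable]: "sq_norm \<in> borel_measurable (PiM UNIV (\<lambda>_. borel))"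
  unfolding sq_norm_def[abs_def] by measurable

lemma has_integral_normal_vector_component:
  assumes "0 < \<sigma>" and [measurable]: "f \<in> borel_measurable borel"
    and "has_bochner_integral lborel (\<lambda>z. normal_density 0 \<sigma> z * f z) c"
  shows "has_bochner_integral (normal_vector \<sigma>) (\<lambda>z. f (z i)) (c :: real)"
proof -
  have "has_bochner_integral (centered_normal \<sigma>) f c"
    using assms(3) unfolding centered_normal_def
    by (intro has_bochner_integral_density) auto
  moreover have "distr (normal_vector \<sigma>) (centered_normal \<sigma>) (\<lambda>z. z i) = centered_normal \<sigma>"
    unfolding normal_vector_def
    by (rule distr_PiM_component) (auto intro: prob_space_centered_normal[OF assms(1)])
  ultimately have "has_bochner_integral (distr (normal_vector \<sigma>) (centered_normal \<sigma>) (\<lambda>z. z i)) f c"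
    by simp
  moreover have [measurable]: "(\<lambda>z. z i) \<in> measurable (normal_vector \<sigma>) (centered_normal \<sigma>)"
    unfolding normal_vector_def by measurable
  ultimately show ?thesis
    by (simp add: has_bochner_integral_iff integrable_distr_eq integral_distr)
qed

lemma normal_vector_moments:
  "has_bochner_integral (normal_vector 1) (\<lambda>z. z i) 0"
  "has_bochner_integral (normal_vector 1) (\<lambda>z. (z i)\<^sup>2) 1"
  "has_bochner_integral (normal_vector 1) (\<lambda>z. (z i) ^ 4) 3"
  using has_integral_normal_vector_component[of 1 "\<lambda>z. z" 0 i]
    has_integral_normal_vector_component[of 1 "\<lambda>z. z\<^sup>2" 1 i]
    has_integral_normal_vector_component[of 1 "\<lambda>z. z ^ 4" 3 i]
    std_normal_moment_odd[of 0] std_normal_moment_even[of 1] std_normal_moment_even[of 2]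
  by (simp_all add: fact_numeral)

text \<open>
  The squared norm is capped at the square of a radius slightly larger than \<open>r\<close>. The margin
  \<open>sqrt r\<close> is negligible against \<open>r\<close>, yet large enough that a single Gaussian step crosses it with
  small probability.
\<close>

definition exit_cap :: "real \<Rightarrow> real" where
  "exit_cap r = (r + sqrt r)\<^sup>2"

text \<open>
  A bound for the mean amount that the cap cuts off in one step from inside the ball; \<open>3 * n\<^sup>2\<close>
  bounds the mean of the squared \<open>sq_norm\<close> of a standard normal vector.
\<close>

definition exit_loss :: "nat \<Rightarrow> real \<Rightarrow> real" where
  "exit_loss n r = (2 / sqrt r + 1 / r) * 3 * (real n)\<^sup>2"

text \<open>
  If the cap is active, the step \<open>z\<close> is longer than \<open>sqrt r\<close>, and then the part cut off,
  at most \<open>2 r t + t\<^sup>2\<close> with \<open>t\<^sup>2 = sq_norm z\<close>, is at most \<open>(2 / sqrt r + 1 / r) t ^ 4\<close>.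
\<close>

lemma capped_sq_norm_lower:
  assumes r: "0 < r" and x: "sq_norm x < r\<^sup>2"
  shows "sq_norm (\<lambda>i. x i + z i) - (2 / sqrt r + 1 / r) * (sq_norm z)\<^sup>2
    \<le> min (sq_norm (\<lambda>i. x i + z i)) (exit_cap r)"
proof -
  define s t where "s = sqrt r" and "t = sqrt (sq_norm z)"
  have s: "0 < s" "s\<^sup>2 = r" using r by (simp_all add: s_def)
  have t: "0 \<le> t" "t\<^sup>2 = sq_norm z" by (simp_all add: t_def sq_norm_nonneg)
  have loss: "0 \<le> (2 / sqrt r + 1 / r) * (sq_norm z)\<^sup>2" using r by simp
  show ?thesis
  proof (cases "sq_norm (\<lambda>i. x i + z i) \<le> exit_cap r")
    case True
    then show ?thesis using loss by simp
  next
    case False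
    have "sqrt (sq_norm x) \<le> r"
      using x r by (intro real_le_lsqrt) auto
    then have "sqrt (sq_norm (\<lambda>i. x i + z i)) \<le> r + t"
      using sq_norm_triangle[of x z] by (simp add: t_def)
    then have u: "sq_norm (\<lambda>i. x i + z i) \<le> (r + t)\<^sup>2"
      by (rule sqrt_le_D)
    with False have "(r + s)\<^sup>2 < (r + t)\<^sup>2" by (simp add: exit_cap_def s_def)
    then have st: "s \<le> t"
      using power2_less_imp_less[of "r + s" "r + t"] r t by simp
    have "1 \<le> t ^ 3 / s ^ 3" "1 \<le> t ^ 2 / s ^ 2"
      using st s by (auto simp: le_divide_eq intro!: power_mono)
    then have "t * 1 \<le> t * (t ^ 3 / s ^ 3)" "t\<^sup>2 * 1 \<le> t\<^sup>2 * (t ^ 2 / s ^ 2)"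
      using t sq_norm_nonneg[of z] by (intro mult_left_mono; simp)+
    then have "2 * r * t \<le> 2 * r * (t * (t ^ 3 / s ^ 3))" "t\<^sup>2 \<le> t\<^sup>2 * (t ^ 2 / s ^ 2)"
      using r mult_left_mono[of t "t * (t ^ 3 / s ^ 3)" "2 * r"] by simp_all
    moreover have "2 * r * (t * (t ^ 3 / s ^ 3)) = 2 / s * (t\<^sup>2)\<^sup>2" "t\<^sup>2 * (t ^ 2 / s ^ 2) = 1 / r * (t\<^sup>2)\<^sup>2"
      using s by (auto simp: s(2)[symmetric] field_simps power2_eq_square eval_nat_numeral)
    ultimately have "2 * r * t + t\<^sup>2 \<le> (2 / s + 1 / r) * (sq_norm z)\<^sup>2"
      by (simp add: t(2) distrib_right)
    moreover have "r\<^sup>2 \<le> exit_cap r"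
      using r unfolding exit_cap_def by (intro power_mono) auto
    moreover have "(r + t)\<^sup>2 = r\<^sup>2 + (2 * r * t + t\<^sup>2)" by (simp add: power2_sum)
    ultimately show ?thesis using u False by (simp add: s_def)
  qed
qed

text \<open>
  Inside the ball the squared norm grows by the dimension in each step, as for the martingale
  \<open>norm (W t)\<^sup>2 - n t\<close>; the cap reduces this growth only by \<open>exit_loss\<close>.
\<close>

lemma capped_sq_norm_step:
  fixes x :: "'n::finite \<Rightarrow> real"
  assumes r: "0 < r" and x: "sq_norm x < r\<^sup>2" and loss: "exit_loss CARD('n) r \<le> CARD('n)"
  shows "ennreal (sq_norm x) + ennreal (CARD('n) - exit_loss CARD('n) r)
    \<le> (\<integral>\<^sup>+z. ennreal (min (sq_norm (\<lambda>i. x i + z i)) (exit_cap r)) \<partial>normal_vector 1)"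
proof -
  let ?N = "normal_vector 1 :: ('n \<Rightarrow> real) measure"
  let ?\<kappa> = "2 / sqrt r + 1 / r" and ?n = "real CARD('n)"
  interpret prob_space ?N by (rule prob_space_normal_vector) simp
  have [simp]: "prob UNIV = 1" using prob_space by simp
  have low: "sq_norm x + 2 * (\<Sum>i\<in>UNIV. x i * z i) + (\<Sum>i\<in>UNIV. (z i)\<^sup>2) - ?\<kappa> * (?n * (\<Sum>i\<in>UNIV. (z i) ^ 4))
    \<le> min (sq_norm (\<lambda>i. x i + z i)) (exit_cap r)" (is "?low z \<le> ?min z") for z
  proof -
    have "?\<kappa> * (sq_norm z)\<^sup>2 \<le> ?\<kappa> * (?n * (\<Sum>i\<in>UNIV. (z i) ^ 4))"
      using r by (intro mult_left_mono sq_norm_square_le) auto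
    then show ?thesis
      using capped_sq_norm_lower[OF r x, of z] by (simp add: sq_norm_add sq_norm_def[of z])
  qed
  have "has_bochner_integral ?N ?low
      (sq_norm x * prob (space ?N) + 2 * (\<Sum>i\<in>(UNIV::'n set). x i * 0) + (\<Sum>i\<in>(UNIV::'n set). 1)
        - ?\<kappa> * (?n * (\<Sum>i\<in>(UNIV::'n set). 3)))"
    by (intro has_bochner_integral_add has_bochner_integral_diff has_bochner_integral_mult_right
        has_bochner_integral_sum normal_vector_moments)
      (auto simp: has_bochner_integral_iff prob_space)
  moreover have "sq_norm x * prob (space ?N) + 2 * (\<Sum>i\<in>(UNIV::'n set). x i * 0) + (\<Sum>i\<in>(UNIV::'n set). 1)
        - ?\<kappa> * (?n * (\<Sum>i\<in>(UNIV::'n set). 3)) = sq_norm x + (?n - exit_loss CARD('n) r)"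
    using prob_space by (simp add: exit_loss_def power2_eq_square)
  ultimately have I: "has_bochner_integral ?N ?low (sq_norm x + (?n - exit_loss CARD('n) r))"
    by (simp only:)
  have cap: "0 \<le> exit_cap r" by (simp add: exit_cap_def)
  have meas: "?min \<in> borel_measurable ?N"
    unfolding sq_norm_def by measurable
  have bound: "norm (?min z) \<le> exit_cap r" for z
    using cap sq_norm_nonneg[of "\<lambda>i. x i + z i"] by (simp add: min_def)
  have int: "integrable ?N ?min"
    by (rule integrable_const_bound[OF AE_I2[OF bound] meas])
  have "sq_norm x + (?n - exit_loss CARD('n) r) \<le> (\<integral>z. ?min z \<partial>?N)"
    using integral_mono[OF integrable.intros[OF I] int low] by (simp add: has_bochner_integral_integral_eq[OF I])
  then have "ennreal (sq_norm x + (?n - exit_loss CARD('n) r)) \<le> ennreal (\<integral>z. ?min z \<partial>?N)"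
    by (rule ennreal_leI)
  also have "\<dots> = (\<integral>\<^sup>+z. ?min z \<partial>?N)"
    by (rule nn_integral_eq_integral[symmetric, OF int]) (use cap sq_norm_nonneg in auto)
  finally show ?thesis
    using loss by (subst ennreal_plus[symmetric]) (auto simp: sq_norm_nonneg)
qed

definition position :: "(nat \<Rightarrow> 'n \<Rightarrow> real) \<Rightarrow> nat \<Rightarrow> 'n \<Rightarrow> real" where
  "position d k = (\<lambda>i. \<Sum>l<k. d l i)"

definition confined :: "real \<Rightarrow> (nat \<Rightarrow> 'n::finite \<Rightarrow> real) \<Rightarrow> nat \<Rightarrow> bool" where
  "confined r d k \<longleftrightarrow> (\<forall>j\<le>k. sq_norm (position d j) < r\<^sup>2)"

text \<open>
  The dimension of the walk enters through the type argument.
\<close>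

definition confinement_prob :: "'n::finite itself \<Rightarrow> real \<Rightarrow> nat \<Rightarrow> ennreal" where
  "confinement_prob _ r k = (\<integral>\<^sup>+d. indicator {d. confined r d k} d
     \<partial>PiM {..<k} (\<lambda>_. normal_vector 1 :: ('n \<Rightarrow> real) measure))"

lemma position_measurable:
  assumes "k \<le> n"
  shows "(\<lambda>d. position d k) \<in> measurable (PiM {..<n} (\<lambda>_. normal_vector \<sigma>)) (PiM UNIV (\<lambda>_. borel))"
proof (rule measurable_PiM_single')
  fix i :: 'a
  show "(\<lambda>d. position d k i) \<in> borel_measurable (PiM {..<n} (\<lambda>_. normal_vector \<sigma>))"
    unfolding position_def
  proof (rule borel_measurable_sum)
    fix l assume "l \<in> {..<k}"
    then have "(\<lambda>d. d l) \<in> measurable (PiM {..<n} (\<lambda>_. normal_vector \<sigma>)) (normal_vector \<sigma> :: ('a \<Rightarrow> real) measure)"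
      using assms by (intro measurable_component_singleton) auto
    moreover have "(\<lambda>v. v i) \<in> borel_measurable (normal_vector \<sigma> :: ('a \<Rightarrow> real) measure)"
      by measurable
    ultimately show "(\<lambda>d. d l i) \<in> borel_measurable (PiM {..<n} (\<lambda>_. normal_vector \<sigma>))"
      by (rule measurable_compose)
  qed
qed auto

lemma confined_measurable:
  assumes "k \<le> n"
  shows "Measurable.pred (PiM {..<n} (\<lambda>_. normal_vector \<sigma>)) (\<lambda>d. confined r d k)"
proof -
  have [measurable]: "(\<lambda>d. sq_norm (position d j)) \<in> borel_measurable (PiM {..<n} (\<lambda>_. normal_vector \<sigma>))"
    if "j \<in> {..k}" for j
    using that assms by (intro measurable_compose[OF position_measurable sq_norm_measurable]) auto
  have "Measurable.pred (PiM {..<n} (\<lambda>_. normal_vector \<sigma>)) (\<lambda>d. \<forall>j\<in>{..k}. sq_norm (position d j) < r\<^sup>2)"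
    by (intro pred_intros_finite) (auto intro!: borel_measurable_pred_less)
  then show ?thesis by (simp add: confined_def)
qed

text \<open>
  Optional stopping for the capped squared norm: it gains at least \<open>\<delta>\<close> in each step that starts
  inside the ball and never exceeds the cap.
\<close>

lemma confinement_sum_le:
  fixes r :: real
  defines "\<delta> \<equiv> real CARD('n::finite) - exit_loss CARD('n) r"
  assumes r: "0 < r" and \<delta>: "0 \<le> \<delta>"
  shows "ennreal \<delta> * (\<Sum>k<K. confinement_prob TYPE('n) r k) \<le> ennreal (exit_cap r)"
proof -
  let ?P = "\<lambda>k. PiM {..<k} (\<lambda>_. normal_vector 1 :: ('n \<Rightarrow> real) measure)"
  let ?B = "exit_cap r"
  let ?p = "confinement_prob TYPE('n) r"
  let ?I = "\<lambda>d k. indicator {d :: nat \<Rightarrow> 'n \<Rightarrow> real. confined r d k} d :: ennreal"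
  define a where "a k = (\<integral>\<^sup>+d. ?I d k * ennreal (sq_norm (position d k)) \<partial>?P k)" for k
  have prob: "prob_space (normal_vector 1 :: ('n \<Rightarrow> real) measure)"
    by (rule prob_space_normal_vector) simp
  interpret N: prob_space "normal_vector 1 :: ('n \<Rightarrow> real) measure" by (rule prob)
  have probP: "prob_space (?P k)" for k by (rule prob_space_PiM[OF prob])
  have B: "0 \<le> ?B" "r\<^sup>2 \<le> ?B" using r by (auto simp: exit_cap_def intro: power_mono)
  have I_measurable [measurable]: "(\<lambda>d. ?I d k) \<in> borel_measurable (?P n)" if "k \<le> n" for k n
  proof -
    have "(\<lambda>d. if confined r d k then 1 else 0 :: ennreal) \<in> borel_measurable (?P n)"
      using confined_measurable[OF that, where r = r and \<sigma> = 1] by (intro measurable_If) (auto simp: pred_def)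
    then show ?thesis by (simp add: indicator_def[abs_def] of_bool_def)
  qed
  have sq_measurable [measurable]: "(\<lambda>d. sq_norm (position d k)) \<in> borel_measurable (?P n)" if "k \<le> n" for k n
    by (rule measurable_compose[OF position_measurable[OF that] sq_norm_measurable])
  have lin: "(\<integral>\<^sup>+d. f d + c * ?I d j \<partial>?P m) = (\<integral>\<^sup>+d. f d \<partial>?P m) + c * (\<integral>\<^sup>+d. ?I d j \<partial>?P m)"
    if "f \<in> borel_measurable (?P m)" "j \<le> m" for f c j m
    using nn_integral_add[OF that(1) borel_measurable_times_ennreal[OF measurable_const[of c] I_measurable[OF that(2)]]]
      nn_integral_cmult[OF I_measurable[OF that(2)], of c] by simp
  have times: "(\<lambda>d. ?I d j * ennreal (g d)) \<in> borel_measurable (?P m)"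
    if "j \<le> m" "g \<in> borel_measurable (?P m)" for j m g
    by (rule borel_measurable_times_ennreal[OF I_measurable[OF that(1)] measurable_compose_rev[OF measurable_ennreal that(2)]])
  have min_measurable: "(\<lambda>d. min (sq_norm (position d k)) ?B) \<in> borel_measurable (?P k)" for k
    by (intro borel_measurable_min sq_measurable) auto
  have upd: "position (d(k := z)) j = position d j" if "j \<le> k" for d k j and z :: "'n \<Rightarrow> real"
    using that by (auto simp: position_def fun_eq_iff intro!: sum.cong)
  have conf_upd: "confined r (d(k := z)) k \<longleftrightarrow> confined r d k" for d k and z :: "'n \<Rightarrow> real"
    by (simp add: confined_def upd)
  have pos_Suc: "position (d(k := z)) (Suc k) = (\<lambda>i. position d k i + z i)" for d k and z :: "'n \<Rightarrow> real"
    using upd[of k k d z] by (simp add: position_def fun_eq_iff)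
  have p_le: "?p k \<le> 1" for k
  proof -
    have "?p k \<le> (\<integral>\<^sup>+d. 1 \<partial>?P k)"
      unfolding confinement_prob_def by (intro nn_integral_mono) (auto simp: indicator_def)
    also have "\<dots> = 1" using prob_space.emeasure_space_1[OF probP[of k]] by simp
    finally show ?thesis .
  qed
  have a_le: "a k \<le> ennreal ?B * ?p k" for k
  proof -
    have "a k \<le> (\<integral>\<^sup>+d. ennreal ?B * ?I d k \<partial>?P k)"
      unfolding a_def
    proof (rule nn_integral_mono)
      fix d :: "nat \<Rightarrow> 'n \<Rightarrow> real"
      have "sq_norm (position d k) \<le> ?B" if "confined r d k"
        using that B by (auto simp: confined_def dest!: spec[of _ k])
      then show "?I d k * ennreal (sq_norm (position d k)) \<le> ennreal ?B * ?I d k"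
        by (auto simp: indicator_def intro: ennreal_leI)
    qed
    also have "\<dots> = ennreal ?B * ?p k"
      unfolding confinement_prob_def by (rule nn_integral_cmult) measurable
    finally show ?thesis .
  qed
  \<comment> \<open>Walks that leave the ball in this step are charged the full cap: these are the terms with the cap as a factor.\<close>
  have step: "a k + ennreal \<delta> * ?p k + ennreal ?B * ?p (Suc k) \<le> a (Suc k) + ennreal ?B * ?p k" for k
  proof -
    let ?m = "\<lambda>d. ennreal (min (sq_norm (position d (Suc k))) ?B)"
    have "a k + ennreal \<delta> * ?p k = (\<integral>\<^sup>+d. ?I d k * ennreal (sq_norm (position d k)) + ennreal \<delta> * ?I d k \<partial>?P k)"
      unfolding a_def confinement_prob_def by (intro lin[symmetric] times sq_measurable order_refl)
    also have "\<dots> = (\<integral>\<^sup>+d. ?I d k * (ennreal (sq_norm (position d k)) + ennreal \<delta>) \<partial>?P k)"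
      by (intro nn_integral_cong) (auto simp: indicator_def)
    also have "\<dots> \<le> (\<integral>\<^sup>+d. \<integral>\<^sup>+z. ?I d k * ?m (d(k := z)) \<partial>normal_vector 1 \<partial>?P k)"
    proof (rule nn_integral_mono)
      fix d :: "nat \<Rightarrow> 'n \<Rightarrow> real"
      show "?I d k * (ennreal (sq_norm (position d k)) + ennreal \<delta>)
          \<le> (\<integral>\<^sup>+z. ?I d k * ?m (d(k := z)) \<partial>normal_vector 1)"
      proof (cases "confined r d k")
        case True
        then have "sq_norm (position d k) < r\<^sup>2" by (simp add: confined_def)
        from capped_sq_norm_step[OF r this] True \<delta> show ?thesis
          by (simp add: pos_Suc \<delta>_def)
      qed simp
    qed
    also have "\<dots> = (\<integral>\<^sup>+d. ?I d k * ?m d \<partial>?P (Suc k))"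
      by (subst nn_integral_PiM_Suc[OF prob])
        (use times[OF _ min_measurable] in \<open>auto simp: conf_upd indicator_def\<close>)
    finally have "a k + ennreal \<delta> * ?p k + ennreal ?B * ?p (Suc k) \<le>
        (\<integral>\<^sup>+d. ?I d k * ?m d \<partial>?P (Suc k)) + ennreal ?B * ?p (Suc k)"
      by (rule add_right_mono)
    also have "\<dots> = (\<integral>\<^sup>+d. ?I d k * ?m d + ennreal ?B * ?I d (Suc k) \<partial>?P (Suc k))"
      unfolding confinement_prob_def by (intro lin[symmetric] times min_measurable) auto
    also have "\<dots> \<le> (\<integral>\<^sup>+d. ?I d (Suc k) * ennreal (sq_norm (position d (Suc k))) + ennreal ?B * ?I d k \<partial>?P (Suc k))"
    proof (rule nn_integral_mono)
      fix d :: "nat \<Rightarrow> 'n \<Rightarrow> real"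
      have "confined r d (Suc k) \<Longrightarrow> confined r d k" by (simp add: confined_def)
      then show "?I d k * ?m d + ennreal ?B * ?I d (Suc k)
          \<le> ?I d (Suc k) * ennreal (sq_norm (position d (Suc k))) + ennreal ?B * ?I d k"
        by (auto simp: indicator_def intro!: ennreal_leI)
    qed
    also have "\<dots> = a (Suc k) + ennreal ?B * (\<integral>\<^sup>+d. ?I d k \<partial>?P (Suc k))"
      unfolding a_def by (intro lin times sq_measurable) auto
    also have "(\<integral>\<^sup>+d. ?I d k \<partial>?P (Suc k)) = (\<integral>\<^sup>+d. \<integral>\<^sup>+z. ?I (d(k := z)) k \<partial>normal_vector 1 \<partial>?P k)"
      by (intro nn_integral_PiM_Suc[OF prob] I_measurable) simp
    also have "\<dots> = (\<integral>\<^sup>+d. ?I d k \<partial>?P k)"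
      by (intro nn_integral_cong) (simp add: indicator_def conf_upd N.emeasure_space_1[simplified])
    also have "\<dots> = ?p k"
      by (simp add: confinement_prob_def)
    finally show ?thesis .
  qed
  have "\<exists>p'\<ge>0. ?p k = ennreal p' \<and> p' \<le> 1" for k
    using p_le[of k] by (cases "?p k") (auto simp: top_unique)
  then obtain p' where p': "\<And>k. 0 \<le> p' k" "\<And>k. ?p k = ennreal (p' k)" "\<And>k. p' k \<le> 1" by metis
  have "\<exists>a'\<ge>0. a k = ennreal a' \<and> a' \<le> ?B * p' k" for k
    using a_le[of k] B p'(1,2)[of k]
    by (cases "a k") (auto simp: top_unique ennreal_mult_eq_top_iff ennreal_mult[symmetric])
  then obtain a' where a': "\<And>k. 0 \<le> a' k" "\<And>k. a k = ennreal (a' k)" "\<And>k. a' k \<le> ?B * p' k" by metis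
  have step': "a' k + \<delta> * p' k + ?B * p' (Suc k) \<le> a' (Suc k) + ?B * p' k" for k
    using step[of k] \<delta> B p'(1) a'(1)
    by (simp add: p'(2) a'(2) ennreal_mult[symmetric] ennreal_plus[symmetric] del: ennreal_plus)
  have "\<delta> * (\<Sum>k<K. p' k) + ?B * p' K \<le> a' K + ?B * p' 0"
  proof (induction K)
    case 0
    then show ?case using a'(1)[of 0] by simp
  next
    case (Suc K)
    then show ?case using step'[of K] by (simp add: distrib_left)
  qed
  then have "\<delta> * (\<Sum>k<K. p' k) \<le> ?B * p' 0" using a'(3)[of K] by simp
  also have "\<dots> \<le> ?B" using B p'(3)[of 0] by (simp add: mult_left_le)
  finally have "ennreal (\<delta> * (\<Sum>k<K. p' k)) \<le> ennreal ?B" by (rule ennreal_leI)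
  then show ?thesis
    using \<delta> p'(1) by (simp add: p'(2) sum_ennreal ennreal_mult sum_nonneg)
qed

section \<open>From confinement probabilities to a first moment\<close>

text \<open>
  The indices \<open>k\<close> with \<open>y * sqrt k < r\<close> are those below \<open>(r / y)\<^sup>2\<close>. The case \<open>y = 0\<close>, in which both
  sides are infinite, is kept so that positivity of the random variable becomes a consequence.
\<close>

lemma reciprocal_le_count:
  fixes y r :: real
  assumes "0 \<le> y" "0 < r"
  shows "ennreal (r\<^sup>2) * inverse (ennreal (y\<^sup>2)) \<le> (\<Sum>k. if y * sqrt (real k) < r then 1 else 0)"
    (is "_ \<le> suminf ?f")
proof -
  have count: "of_nat K \<le> suminf ?f" if "\<And>k. k < K \<Longrightarrow> y * sqrt (real k) < r" for K
  proof -
    have "of_nat K = (\<Sum>k<K. ?f k)" using that by simp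
    also have "\<dots> \<le> suminf ?f" by (rule sum_le_suminf) auto
    finally show ?thesis .
  qed
  show ?thesis
  proof (cases "y = 0")
    case True
    have "suminf ?f = top"
    proof (rule ccontr)
      assume "suminf ?f \<noteq> top"
      then obtain K where "suminf ?f < of_nat K"
        using ennreal_Ex_less_of_nat by (auto simp: less_top)
      moreover have "of_nat K \<le> suminf ?f" using True assms by (intro count) auto
      ultimately show False by simp
    qed
    then show ?thesis by simp
  next
    case False
    then have y: "0 < y" using assms by simp
    have small: "real k < r\<^sup>2 / y\<^sup>2 \<Longrightarrow> y * sqrt (real k) < r" for k
    proof -
      assume "real k < r\<^sup>2 / y\<^sup>2"
      then have "(y * sqrt (real k))\<^sup>2 < r\<^sup>2"
        using y by (simp add: power_mult_distrib field_simps)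
      then show ?thesis using assms by (simp add: power2_less_imp_less)
    qed
    have a: "of_nat (nat \<lceil>r\<^sup>2 / y\<^sup>2\<rceil>) \<le> suminf ?f"
      by (intro count small) (simp add: zless_nat_eq_int_zless less_ceiling_iff)
    have b: "ennreal (r\<^sup>2 / y\<^sup>2) \<le> of_nat (nat \<lceil>r\<^sup>2 / y\<^sup>2\<rceil>)"
      unfolding ennreal_of_nat_eq_real_of_nat by (intro ennreal_leI) (rule real_nat_ceiling_ge)
    have "ennreal (r\<^sup>2) * inverse (ennreal (y\<^sup>2)) = ennreal (r\<^sup>2 / y\<^sup>2)"
      using y by (simp add: inverse_ennreal ennreal_mult'[symmetric] divide_inverse)
    with order_trans[OF b a] show ?thesis by simp
  qed
qed

lemma exit_loss_tendsto: "((\<lambda>r. real n - exit_loss n r) \<longlongrightarrow> real n) at_top"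
proof -
  have "((\<lambda>r::real. 2 / sqrt r + 1 / r) \<longlongrightarrow> 0) at_top" by real_asymp
  then have "((\<lambda>r. real n - (2 / sqrt r + 1 / r) * 3 * (real n)\<^sup>2) \<longlongrightarrow> real n - 0 * 3 * (real n)\<^sup>2) at_top"
    by (intro tendsto_intros)
  then show ?thesis by (simp add: exit_loss_def)
qed

lemma exit_cap_tendsto: "((\<lambda>r. exit_cap r / r\<^sup>2) \<longlongrightarrow> 1) at_top"
  unfolding exit_cap_def by real_asymp

text \<open>
  Summing the hypothesis over \<open>k\<close> bounds the mean of \<open>(r / Y)\<^sup>2\<close> by the expected exit time; dividing
  by \<open>r\<^sup>2\<close> and letting \<open>r\<close> grow bounds the mean of \<open>1 / Y\<^sup>2\<close> by \<open>1 / n\<close>. Jensen's inequality is used in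
  the form of a tangent line.
\<close>

lemma (in prob_space) sqrt_dim_le_expectation:
  fixes Y :: "'a \<Rightarrow> real"
  assumes Y: "integrable M Y" "AE \<omega> in M. 0 \<le> Y \<omega>"
    and dom: "\<And>k r. 0 < r \<Longrightarrow> emeasure M {\<omega> \<in> space M. Y \<omega> * sqrt (real k) < r} \<le> confinement_prob TYPE('n::finite) r k"
  shows "sqrt (real CARD('n)) \<le> expectation Y"
proof -
  let ?n = "real CARD('n)"
  have n: "0 < ?n" by simp
  have [measurable]: "Y \<in> borel_measurable M" using Y(1) by auto
  define G where "G = (\<integral>\<^sup>+\<omega>. inverse (ennreal ((Y \<omega>)\<^sup>2)) \<partial>M)"
  have G: "ennreal (?n - exit_loss CARD('n) r) * (ennreal (r\<^sup>2) * G) \<le> ennreal (exit_cap r)"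
    if r: "0 < r" and \<delta>: "0 \<le> ?n - exit_loss CARD('n) r" for r
  proof -
    have "ennreal (r\<^sup>2) * G = (\<integral>\<^sup>+\<omega>. ennreal (r\<^sup>2) * inverse (ennreal ((Y \<omega>)\<^sup>2)) \<partial>M)"
      unfolding G_def by (rule nn_integral_cmult[symmetric]) measurable
    also have "\<dots> \<le> (\<integral>\<^sup>+\<omega>. (\<Sum>k. if Y \<omega> * sqrt (real k) < r then 1 else 0) \<partial>M)"
      using Y(2) by (intro nn_integral_mono_AE) (auto intro: reciprocal_le_count r)
    also have "\<dots> = (\<Sum>k. \<integral>\<^sup>+\<omega>. (if Y \<omega> * sqrt (real k) < r then 1 else 0) \<partial>M)"
      by (rule nn_integral_suminf) measurable
    also have "\<dots> \<le> (\<Sum>k. confinement_prob TYPE('n) r k)"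
    proof (intro suminf_le allI)
      fix k
      have "(\<integral>\<^sup>+\<omega>. (if Y \<omega> * sqrt (real k) < r then 1 else 0) \<partial>M)
          = (\<integral>\<^sup>+\<omega>. indicator {\<omega> \<in> space M. Y \<omega> * sqrt (real k) < r} \<omega> \<partial>M)"
        by (intro nn_integral_cong) (auto simp: indicator_def)
      also have "\<dots> = emeasure M {\<omega> \<in> space M. Y \<omega> * sqrt (real k) < r}"
        by (rule nn_integral_indicator) measurable
      finally show "(\<integral>\<^sup>+\<omega>. (if Y \<omega> * sqrt (real k) < r then 1 else 0) \<partial>M) \<le> confinement_prob TYPE('n) r k"
        using dom[OF r] by simp
    qed auto
    finally have "ennreal (?n - exit_loss CARD('n) r) * (ennreal (r\<^sup>2) * G)
        \<le> ennreal (?n - exit_loss CARD('n) r) * (\<Sum>k. confinement_prob TYPE('n) r k)"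
      by (intro mult_left_mono) auto
    also have "\<dots> = (\<Sum>k. ennreal (?n - exit_loss CARD('n) r) * confinement_prob TYPE('n) r k)"
      by simp
    also have "\<dots> \<le> ennreal (exit_cap r)"
      using confinement_sum_le[OF r \<delta>]
      by (intro suminf_le_const) (auto simp: sum_distrib_left)
    finally show ?thesis .
  qed
  have ev: "\<forall>\<^sub>F r in at_top. 0 < r \<and> 0 < ?n - exit_loss CARD('n) r"
    using eventually_conj[OF eventually_gt_at_top[of "0::real"] order_tendstoD(1)[OF exit_loss_tendsto, of 0 "CARD('n)"]]
    by simp
  then obtain r0 where "\<forall>r\<ge>r0. 0 < r \<and> 0 < ?n - exit_loss CARD('n) r"
    unfolding eventually_at_top_linorder by blast
  then have r0: "0 < r0" "0 < ?n - exit_loss CARD('n) r0" by auto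
  have "G \<noteq> top"
  proof
    assume "G = top"
    then show False using G[of r0] r0 by (simp add: ennreal_mult_top top_unique)
  qed
  then obtain x where x: "0 \<le> x" "G = ennreal x" by (cases G) auto
  have "(?n - exit_loss CARD('n) r) * x \<le> exit_cap r / r\<^sup>2"
    if r: "0 < r \<and> 0 < ?n - exit_loss CARD('n) r" for r
  proof -
    have "ennreal ((?n - exit_loss CARD('n) r) * (r\<^sup>2 * x)) \<le> ennreal (exit_cap r)"
      using G[of r] r x by (simp add: ennreal_mult)
    then have "(?n - exit_loss CARD('n) r) * (r\<^sup>2 * x) \<le> exit_cap r"
      by (subst (asm) ennreal_le_iff) (auto simp: exit_cap_def)
    then show ?thesis using r by (simp add: field_simps)
  qed
  then have ev': "\<forall>\<^sub>F r in at_top. (?n - exit_loss CARD('n) r) * x \<le> exit_cap r / r\<^sup>2"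
    using ev by (rule eventually_mono[rotated])
  have nx: "?n * x \<le> 1"
    by (rule tendsto_le[OF _ exit_cap_tendsto tendsto_mult_right[OF exit_loss_tendsto] ev']) simp
  have "AE \<omega> in M. inverse (ennreal ((Y \<omega>)\<^sup>2)) \<noteq> \<infinity>"
    using \<open>G \<noteq> top\<close> unfolding G_def by (intro nn_integral_PInf_AE) auto
  with Y(2) have pos: "AE \<omega> in M. 0 < Y \<omega>"
    by eventually_elim (auto simp: less_le)
  have "(\<integral>\<^sup>+\<omega>. ennreal (1 / (Y \<omega>)\<^sup>2) \<partial>M) = ennreal x"
    unfolding x(2)[symmetric] G_def using pos
    by (intro nn_integral_cong_AE) (auto elim!: eventually_mono simp: inverse_ennreal inverse_eq_divide)
  then have I: "integrable M (\<lambda>\<omega>. 1 / (Y \<omega>)\<^sup>2)" "expectation (\<lambda>\<omega>. 1 / (Y \<omega>)\<^sup>2) = x"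
    using x(1) by (auto intro!: integrableI_nn_integral_finite simp: integral_eq_nn_integral)
  have "expectation (\<lambda>\<omega>. sqrt ?n * (3 / 2) - sqrt ?n * ?n / 2 * (1 / (Y \<omega>)\<^sup>2)) \<le> expectation Y"
  proof (rule integral_mono_AE)
    show "AE \<omega> in M. sqrt ?n * (3 / 2) - sqrt ?n * ?n / 2 * (1 / (Y \<omega>)\<^sup>2) \<le> Y \<omega>"
      using pos
    proof eventually_elim
      case (elim \<omega>)
      define s y where "s = sqrt ?n" and "y = Y \<omega>"
      have sy: "0 < s" "0 < y" "?n = s\<^sup>2" using elim by (simp_all add: s_def y_def)
      \<comment> \<open>As a convex function of 1 / y^2, y lies above its tangent at y = s; the defect factors like this.\<close>
      have "0 \<le> (y - s)\<^sup>2 * (2 * y + s)" using sy by simp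
      also have "\<dots> = 2 * y ^ 3 - 3 * s * y\<^sup>2 + s ^ 3"
        by (simp add: power2_eq_square power3_eq_cube algebra_simps)
      finally have "s * (3 / 2) - s * s\<^sup>2 / 2 * (1 / y\<^sup>2) \<le> y"
        using sy by (simp add: field_simps power2_eq_square power3_eq_cube)
      then show ?case unfolding sy(3)[symmetric] by (simp only: s_def y_def)
    qed
    show "integrable M (\<lambda>\<omega>. sqrt ?n * (3 / 2) - sqrt ?n * ?n / 2 * (1 / (Y \<omega>)\<^sup>2))"
      by (intro Bochner_Integration.integrable_diff integrable_mult_right I(1)) auto
  qed (rule Y(1))
  moreover have "expectation (\<lambda>\<omega>. sqrt ?n * (3 / 2) - sqrt ?n * ?n / 2 * (1 / (Y \<omega>)\<^sup>2))
      = sqrt ?n * (3 / 2) - sqrt ?n * ?n / 2 * x"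
    unfolding Bochner_Integration.integral_diff[OF integrable_const integrable_mult_right[OF I(1)]]
      integral_mult_right_zero I(2) by (simp add: prob_space)
  moreover have "sqrt ?n * ?n / 2 * x \<le> sqrt ?n / 2"
    using mult_left_mono[OF nx, of "sqrt ?n / 2"] by (simp add: mult_ac)
  ultimately show ?thesis by linarith
qed

section \<open>Increments of Brownian motion on a grid\<close>

lemma (in standard_brownian_motion_1d) distr_increment:
  assumes "0 < h" "0 < c" "0 \<le> s"
  shows "distr M borel (\<lambda>\<omega>. c * (B (s + h) \<omega> - B s \<omega>)) = centered_normal (c * sqrt h)"
proof -
  have "distributed M lborel (\<lambda>\<omega>. B (s + h) \<omega> - B s \<omega>) (normal_density 0 (sqrt (s + h - s)))"
    using assms by (intro normal_increments) auto
  then have "distr M lborel (\<lambda>\<omega>. B (s + h) \<omega> - B s \<omega>) = centered_normal (sqrt h)"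
    by (simp add: distributed_def centered_normal_def)
  moreover have "distr M lborel (\<lambda>\<omega>. B (s + h) \<omega> - B s \<omega>) = distr M borel (\<lambda>\<omega>. B (s + h) \<omega> - B s \<omega>)"
    by (rule distr_cong) auto
  ultimately have "centered_normal (c * sqrt h) = distr (distr M borel (\<lambda>\<omega>. B (s + h) \<omega> - B s \<omega>)) borel (\<lambda>z. c * z)"
    using assms by (simp add: centered_normal_scale)
  also have "\<dots> = distr M borel (\<lambda>\<omega>. c * (B (s + h) \<omega> - B s \<omega>))"
    using assms by (subst distr_distr) (auto simp: comp_def intro!: borel_measurable_diff measurable_B)
  finally show ?thesis by simp
qed

text \<open>
  The factor \<open>c\<close> normalises the steps: \<open>c = 1 / sqrt h\<close> makes them standard normal.
\<close>

definition step_increments :: "(real \<Rightarrow> 'w \<Rightarrow> real) \<Rightarrow> real \<Rightarrow> real \<Rightarrow> 'w \<Rightarrow> nat \<Rightarrow> real" where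
  "step_increments B c h \<omega> l = c * (B (real l * h + h) \<omega> - B (real l * h) \<omega>)"

lemma sum_step_increments: "(\<Sum>l<k. step_increments B c h \<omega> l) = c * (B (real k * h) \<omega> - B 0 \<omega>)"
  unfolding step_increments_def
  by (induction k) (simp_all add: algebra_simps)

lemma (in standard_brownian_motion_1d) step_increments_measurable [measurable]:
  "0 < h \<Longrightarrow> (\<lambda>\<omega>. step_increments B c h \<omega> l) \<in> borel_measurable M"
  unfolding step_increments_def by (intro borel_measurable_times borel_measurable_diff measurable_B) auto

lemma (in standard_brownian_motion_1d) indep_step_increments:
  assumes "0 < h"
  shows "indep_vars (\<lambda>_. borel) (\<lambda>l \<omega>. step_increments B c h \<omega> l) {..<k}"
proof -
  have "indep_vars (\<lambda>_. borel) (\<lambda>l \<omega>. B (real (Suc l) * h) \<omega> - B (real l * h) \<omega>) {..<k}"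
    using assms by (intro indep_increments) (auto intro!: mult_right_mono)
  then have "indep_vars (\<lambda>_. borel) (\<lambda>l \<omega>. c * (B (real (Suc l) * h) \<omega> - B (real l * h) \<omega>)) {..<k}"
    by (rule indep_vars_compose2[where Y = "\<lambda>_ z. c * z"]) auto
  then show ?thesis by (simp add: step_increments_def[abs_def] algebra_simps)
qed

lemma (in standard_brownian_motion_1d) distr_step_increments:
  assumes "0 < h" "0 < c" "0 < k"
  shows "distr M (PiM {..<k} (\<lambda>_. borel)) (\<lambda>\<omega>. \<lambda>l\<in>{..<k}. step_increments B c h \<omega> l)
    = PiM {..<k} (\<lambda>_. centered_normal (c * sqrt h))"
proof -
  have "{..<k} \<noteq> {}" using assms by auto
  moreover have "distr M borel (\<lambda>\<omega>. step_increments B c h \<omega> l) = centered_normal (c * sqrt h)" for l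
    unfolding step_increments_def using assms by (intro distr_increment) auto
  ultimately show ?thesis
    using indep_step_increments[OF assms(1), of c k] assms(1)
    by (subst (asm) indep_vars_iff_distr_eq_PiM) auto
qed

lemma (in standard_brownian_motion_1d) mean_sq_range_grid:
  assumes "0 < h" "0 < k"
  shows "(\<integral>\<^sup>+\<omega>. ennreal ((walk_range (step_increments B 1 h \<omega>) k)\<^sup>2) \<partial>M) = mean_sq_range (sqrt h) k"
proof -
  let ?X = "\<lambda>\<omega>. \<lambda>l\<in>{..<k}. step_increments B 1 h \<omega> l"
  have X: "?X \<in> measurable M (PiM {..<k} (\<lambda>_. borel))"
    using assms by (intro measurable_restrict step_increments_measurable)
  have f: "(\<lambda>d. ennreal ((walk_range d k)\<^sup>2)) \<in> borel_measurable (PiM {..<k} (\<lambda>_. borel))"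
    unfolding walk_range_def
    by (intro measurable_compose[OF _ measurable_ennreal] borel_measurable_power borel_measurable_diff borel_measurable_walk) auto
  have "walk_range (step_increments B 1 h \<omega>) k = walk_range (?X \<omega>) k" for \<omega>
    unfolding walk_range_def by (intro arg_cong2[where f = minus] walk_cong) auto
  then have "(\<integral>\<^sup>+\<omega>. ennreal ((walk_range (step_increments B 1 h \<omega>) k)\<^sup>2) \<partial>M) =
      (\<integral>\<^sup>+d. ennreal ((walk_range d k)\<^sup>2) \<partial>distr M (PiM {..<k} (\<lambda>_. borel)) ?X)"
    by (subst nn_integral_distr[OF X]) (use f in simp_all)
  then show ?thesis
    using distr_step_increments[of h 1 k] assms by (simp add: mean_sq_range_def)
qed

context standard_brownian_motion
begin

abbreviation coord_increments :: "real \<Rightarrow> real \<Rightarrow> 'w \<Rightarrow> nat \<Rightarrow> 'n \<Rightarrow> real" where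
  "coord_increments c h \<omega> l i \<equiv> step_increments (\<lambda>t \<omega>. W t \<omega> $ i) c h \<omega> l"

lemma coord_increments_measurable:
  "0 < h \<Longrightarrow> (\<lambda>\<omega>. coord_increments c h \<omega> l i) \<in> borel_measurable M"
  by (rule standard_brownian_motion_1d.step_increments_measurable[OF coordinate_brownian])

lemma indep_coord_increments:
  assumes h: "0 < h"
  shows "indep_vars (\<lambda>_. PiM {..<k} (\<lambda>_. borel)) (\<lambda>i \<omega>. \<lambda>l\<in>{..<k}. coord_increments c h \<omega> l i) UNIV"
proof -
  have "indep_vars (\<lambda>_. PiM {..<k} (\<lambda>_. borel)) (\<lambda>i \<omega>. (\<lambda>p. \<lambda>l\<in>{..<k}. c * (p (real l * h + h) - p (real l * h)))
      (\<lambda>t\<in>{0..}. W t \<omega> $ i)) UNIV"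
  proof (rule indep_vars_compose2[OF indep_coordinates])
    have [measurable]: "(\<lambda>p :: real \<Rightarrow> real. p t) \<in> borel_measurable (PiM {0..} (\<lambda>_. borel))" if "0 \<le> t" for t
      using that by (intro measurable_component_singleton) auto
    show "(\<lambda>p. \<lambda>l\<in>{..<k}. c * (p (real l * h + h) - p (real l * h))) \<in> PiM {0..} (\<lambda>_. borel) \<rightarrow>\<^sub>M PiM {..<k} (\<lambda>_. borel)"
      using h by (intro measurable_restrict) simp
  qed
  then show ?thesis using h by (simp add: step_increments_def cong: restrict_cong)
qed

text \<open>
  Independence within each coordinate and independence of the coordinates combine to independence of
  the whole array of increments, because the probability of a box factors first over the columns and
  then inside each column.
\<close>

lemma indep_all_increments:
  assumes h: "0 < h" and k: "0 < k"
  shows "indep_vars (\<lambda>_. borel) (\<lambda>p \<omega>. coord_increments c h \<omega> (fst p) (snd p)) ({..<k} \<times> UNIV)"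
proof -
  have ne: "{..<k} \<times> (UNIV :: 'n set) \<noteq> {}" using k by auto
  let ?X = "\<lambda>p \<omega>. coord_increments c h \<omega> (fst p) (snd p)"
  have prod: "prob (\<Inter>p\<in>{..<k} \<times> UNIV. ?X p -` A p \<inter> space M) = (\<Prod>p\<in>{..<k} \<times> UNIV. prob (?X p -` A p \<inter> space M))"
    if A: "A \<in> ({..<k} \<times> UNIV \<rightarrow> sets borel)" for A
  proof -
    let ?V = "\<lambda>i \<omega>. \<lambda>l\<in>{..<k}. coord_increments c h \<omega> l i"
    let ?A = "\<lambda>i. PiE {..<k} (\<lambda>l. A (l, i))"
    have A': "A (l, i) \<in> sets borel" if "l < k" for l i using A that by auto
    have col: "?V i -` ?A i \<inter> space M = (\<Inter>l\<in>{..<k}. (\<lambda>\<omega>. coord_increments c h \<omega> l i) -` A (l, i) \<inter> space M)" for i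
      using k by (auto simp: PiE_iff)
    have "(\<Inter>p\<in>{..<k} \<times> UNIV. ?X p -` A p \<inter> space M) = (\<Inter>i\<in>UNIV. ?V i -` ?A i \<inter> space M)"
      unfolding col by auto
    also have "prob \<dots> = (\<Prod>i\<in>UNIV. prob (?V i -` ?A i \<inter> space M))"
      by (rule indep_varsD_finite[OF indep_coord_increments[OF h]]) (auto intro!: sets_PiM_I_finite A')
    also have "\<dots> = (\<Prod>i\<in>UNIV. \<Prod>l<k. prob ((\<lambda>\<omega>. coord_increments c h \<omega> l i) -` A (l, i) \<inter> space M))"
    proof (rule prod.cong[OF refl])
      fix i
      show "prob (?V i -` ?A i \<inter> space M) = (\<Prod>l<k. prob ((\<lambda>\<omega>. coord_increments c h \<omega> l i) -` A (l, i) \<inter> space M))"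
        unfolding col
        by (rule indep_varsD_finite[OF standard_brownian_motion_1d.indep_step_increments[OF coordinate_brownian h]])
          (use k A' in auto)
    qed
    also have "\<dots> = (\<Prod>p\<in>{..<k} \<times> UNIV. prob (?X p -` A p \<inter> space M))"
      by (subst prod.swap) (simp add: prod.cartesian_product case_prod_beta)
    finally show ?thesis .
  qed
  show ?thesis
  proof (subst indep_vars_finite[OF ne, where E = "\<lambda>_. sets borel"])
    show "finite ({..<k} \<times> (UNIV :: 'n set))" by simp
    show "sets borel = sigma_sets (space borel) (sets borel :: real set set)"
      by (rule sets.sigma_sets_eq[symmetric])
    show "?X p \<in> borel_measurable M" for p by (rule coord_increments_measurable[OF h])
    show "Int_stable (sets borel :: real set set)" by (rule sets.Int_stable)
    show "space borel \<in> (sets borel :: real set set)" by (rule sets.top)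
    show "sets borel \<subseteq> Pow (space borel :: real set)" by (rule sets.space_closed)
    show "\<forall>A\<in>{..<k} \<times> UNIV \<rightarrow> sets borel.
        prob (\<Inter>p\<in>{..<k} \<times> UNIV. ?X p -` A p \<inter> space M) = (\<Prod>p\<in>{..<k} \<times> UNIV. prob (?X p -` A p \<inter> space M))"
      using prod by (rule ballI)
  qed
qed

text \<open>
  The array is regrouped by time, so that the walk in space has independent normal vectors as steps.
\<close>

lemma distr_coord_increments:
  assumes h: "0 < h" and k: "0 < k"
  shows "distr M (PiM {..<k} (\<lambda>_. PiM UNIV (\<lambda>_. borel)))
      (\<lambda>\<omega>. \<lambda>l\<in>{..<k}. \<lambda>i. coord_increments (1 / sqrt h) h \<omega> l i)
    = PiM {..<k} (\<lambda>_. normal_vector 1)"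
proof -
  let ?c = "1 / sqrt h"
  let ?X = "\<lambda>p \<omega>. coord_increments ?c h \<omega> (fst p) (snd p)"
  have vec: "(\<lambda>\<omega>. \<lambda>i. coord_increments ?c h \<omega> l i) \<in> M \<rightarrow>\<^sub>M PiM UNIV (\<lambda>_. borel)" for l
    by (rule measurable_PiM_single') (auto simp: coord_increments_measurable[OF h])
  have single: "distr M (PiM UNIV (\<lambda>_. borel)) (\<lambda>\<omega>. \<lambda>i. coord_increments ?c h \<omega> l i) = normal_vector 1" for l
  proof -
    have "indep_vars (\<lambda>_. borel) (\<lambda>i \<omega>. (\<lambda>p. ?c * (p (real l * h + h) - p (real l * h))) (\<lambda>t\<in>{0..}. W t \<omega> $ i)) UNIV"
    proof (rule indep_vars_compose2[OF indep_coordinates])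
      have [measurable]: "(\<lambda>p :: real \<Rightarrow> real. p t) \<in> borel_measurable (PiM {0..} (\<lambda>_. borel))" if "0 \<le> t" for t
        using that by (intro measurable_component_singleton) auto
      show "(\<lambda>p. ?c * (p (real l * h + h) - p (real l * h))) \<in> borel_measurable (PiM {0..} (\<lambda>_. borel))"
        using h by simp
    qed
    then have "indep_vars (\<lambda>_. borel) (\<lambda>i \<omega>. coord_increments ?c h \<omega> l i) UNIV"
      using h by (simp add: step_increments_def)
    then have "distr M (PiM UNIV (\<lambda>_. borel)) (\<lambda>\<omega>. \<lambda>i\<in>UNIV. coord_increments ?c h \<omega> l i) =
        PiM UNIV (\<lambda>i. distr M borel (\<lambda>\<omega>. coord_increments ?c h \<omega> l i))"
      using coord_increments_measurable[OF h] by (subst (asm) indep_vars_iff_distr_eq_PiM) auto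
    moreover have "distr M borel (\<lambda>\<omega>. coord_increments ?c h \<omega> l i) = centered_normal 1" for i
      using standard_brownian_motion_1d.distr_increment[OF coordinate_brownian h, of ?c "real l * h" i] h
      by (simp add: step_increments_def)
    ultimately show ?thesis by (simp add: normal_vector_def restrict_UNIV)
  qed
  have "indep_vars (\<lambda>l. PiM ({l} \<times> UNIV) (\<lambda>_. borel)) (\<lambda>l \<omega>. \<lambda>p\<in>{l} \<times> UNIV. ?X p \<omega>) {..<k}"
    by (rule indep_vars_restrict[OF indep_all_increments[OF h k]]) (auto simp: disjoint_family_on_def)
  then have "indep_vars (\<lambda>_. PiM UNIV (\<lambda>_. borel)) (\<lambda>l \<omega>. (\<lambda>v i. v (l, i)) (\<lambda>p\<in>{l} \<times> UNIV. ?X p \<omega>)) {..<k}"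
    by (rule indep_vars_compose2) (auto intro!: measurable_PiM_single' measurable_component_singleton)
  then have "indep_vars (\<lambda>_. PiM UNIV (\<lambda>_. borel)) (\<lambda>l \<omega>. \<lambda>i. coord_increments ?c h \<omega> l i) {..<k}"
    by simp
  moreover have "{..<k} \<noteq> {}" using k by auto
  ultimately show ?thesis
    using vec by (subst (asm) indep_vars_iff_distr_eq_PiM) (auto simp: single)
qed

lemma confinement_prob_grid:
  assumes h: "0 < h" and k: "0 < k"
  shows "emeasure M {\<omega> \<in> space M. confined r (coord_increments (1 / sqrt h) h \<omega>) k} = confinement_prob TYPE('n) r k"
    "{\<omega> \<in> space M. confined r (coord_increments (1 / sqrt h) h \<omega>) k} \<in> sets M"
proof -
  let ?X = "\<lambda>\<omega>. \<lambda>l\<in>{..<k}. \<lambda>i. coord_increments (1 / sqrt h) h \<omega> l i"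
  let ?P = "PiM {..<k} (\<lambda>_. normal_vector 1 :: ('n \<Rightarrow> real) measure)"
  let ?C = "{d \<in> space ?P. confined r d k}"
  have sets: "sets (PiM {..<k} (\<lambda>_. PiM (UNIV :: 'n set) (\<lambda>_. borel :: real measure))) = sets ?P"
    by (rule sets_PiM_cong) (auto simp: sets_normal_vector)
  have X: "?X \<in> M \<rightarrow>\<^sub>M PiM {..<k} (\<lambda>_. PiM UNIV (\<lambda>_. borel))"
    by (intro measurable_restrict measurable_PiM_single') (auto simp: coord_increments_measurable[OF h])
  have C: "?C \<in> sets ?P"
    using confined_measurable[of k k r 1] by (simp add: pred_def)
  have "confined r (coord_increments (1 / sqrt h) h \<omega>) k = confined r (?X \<omega>) k" for \<omega>
  proof -
    have "position (coord_increments (1 / sqrt h) h \<omega>) j = position (?X \<omega>) j" if "j \<le> k" for j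
      using that by (auto simp: position_def fun_eq_iff intro!: sum.cong)
    then show ?thesis by (simp add: confined_def)
  qed
  then have eq: "{\<omega> \<in> space M. confined r (coord_increments (1 / sqrt h) h \<omega>) k} = ?X -` ?C \<inter> space M"
    using measurable_space[OF X] sets_eq_imp_space_eq[OF sets] by auto
  show "{\<omega> \<in> space M. confined r (coord_increments (1 / sqrt h) h \<omega>) k} \<in> sets M"
    unfolding eq by (rule measurable_sets[OF X]) (simp only: sets C)
  have "emeasure M (?X -` ?C \<inter> space M) = emeasure ?P ?C"
    using distr_coord_increments[OF h k] emeasure_distr[OF X, of ?C] C sets by simp
  also have "\<dots> = (\<integral>\<^sup>+d. indicator ?C d \<partial>?P)"
    using C by simp
  also have "\<dots> = confinement_prob TYPE('n) r k"
    unfolding confinement_prob_def by (rule nn_integral_cong) (auto simp: indicator_def)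
  finally show "emeasure M {\<omega> \<in> space M. confined r (coord_increments (1 / sqrt h) h \<omega>) k} = confinement_prob TYPE('n) r k"
    unfolding eq .
qed

end

section \<open>The circumradius of a continuous path\<close>

text \<open>
  The minimum in the definition of the circumradius is attained: the sets of centres that serve
  radii slightly above the infimum are nested nonempty compact sets.
\<close>

lemma ex_circumcenter:
  fixes K :: "'a::euclidean_space set"
  assumes K: "K \<noteq> {}" "bounded K"
  obtains c where "K \<subseteq> cball c (circumradius K)" "0 \<le> circumradius K"
    "\<And>c' r. K \<subseteq> cball c' r \<Longrightarrow> circumradius K \<le> r"
proof -
  define A where "A = {r. 0 \<le> r \<and> (\<exists>c. K \<subseteq> cball c r)}"
  define \<rho> where "\<rho> = Inf A"
  define C where "C n = (\<Inter>x\<in>K. cball x (\<rho> + 1 / real (Suc n)))" for n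
  obtain x0 where x0: "x0 \<in> K" using K(1) by auto
  have nonneg: "0 \<le> r" if "K \<subseteq> cball c r" for c r
  proof -
    have "dist c x0 \<le> r" using that x0 by auto
    then show ?thesis using zero_le_dist[of c x0] by linarith
  qed
  obtain r0 c0 where "K \<subseteq> cball c0 r0" using K(2) by (auto simp: bounded_def subset_iff)
  then have A: "A \<noteq> {}" "bdd_below A" using nonneg by (auto simp: A_def intro!: bdd_belowI[of _ 0])
  have "\<Inter> (range C) \<noteq> {}"
  proof (rule compact_nest)
    show "compact (C n)" for n
    proof -
      have "cball x0 (\<rho> + 1 / real (Suc n)) \<inter> C n = C n" using x0 by (auto simp: C_def)
      moreover have "closed (C n)" unfolding C_def by (intro closed_INT) auto
      ultimately show ?thesis using compact_Int_closed[OF compact_cball] by metis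
    qed
    show "C n \<noteq> {}" for n
    proof -
      have "\<exists>r\<in>A. r < \<rho> + 1 / real (Suc n)"
        using A by (subst cInf_less_iff[symmetric]) (auto simp: \<rho>_def)
      then obtain r c where "r < \<rho> + 1 / real (Suc n)" "K \<subseteq> cball c r" by (auto simp: A_def)
      then have "c \<in> C n" by (force simp: C_def dist_commute)
      then show ?thesis by auto
    qed
    show "C n \<subseteq> C m" if "m \<le> n" for m n
    proof -
      have "1 / real (Suc n) \<le> 1 / real (Suc m)" using that by (simp add: frac_le)
      then show ?thesis unfolding C_def by force
    qed
  qed
  then obtain c where c: "\<And>n. c \<in> C n" by auto
  have "dist c x \<le> \<rho>" if "x \<in> K" for x
  proof (rule LIMSEQ_le_const)
    show "(\<lambda>n. \<rho> + 1 / real (Suc n)) \<longlonglongrightarrow> \<rho>" by real_asymp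
    show "\<exists>N. \<forall>n\<ge>N. dist c x \<le> \<rho> + 1 / real (Suc n)"
      using c that unfolding C_def by (metis INT_iff mem_cball dist_commute)
  qed
  then have cover: "K \<subseteq> cball c \<rho>" by auto
  have least: "\<rho> \<le> r" if "K \<subseteq> cball c' r" for c' r
    unfolding \<rho>_def using that nonneg A(2) by (intro cInf_lower) (auto simp: A_def)
  have "circumradius K = \<rho>"
    unfolding circumradius_def
    using cover least nonneg[OF cover] by (intro Least_equality) auto
  then show ?thesis
    using that cover least nonneg[OF cover] by auto
qed

lemma grid_tendsto:
  assumes "0 \<le> t"
  shows "(\<lambda>k. real (nat \<lfloor>t * real k\<rfloor>) * (1 / real k)) \<longlonglongrightarrow> t"
proof (rule tendsto_sandwich)
  have fl: "real (nat \<lfloor>t * real k\<rfloor>) = of_int \<lfloor>t * real k\<rfloor>" for k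
    using assms by simp
  show "\<forall>\<^sub>F k in sequentially. t - 1 / real k \<le> real (nat \<lfloor>t * real k\<rfloor>) * (1 / real k)"
  proof (rule eventually_sequentiallyI[of 1])
    fix k :: nat assume k: "1 \<le> k"
    have "t * real k - 1 \<le> of_int \<lfloor>t * real k\<rfloor>" by linarith
    then have "(t * real k - 1) / real k \<le> of_int \<lfloor>t * real k\<rfloor> / real k"
      by (rule divide_right_mono) simp
    then show "t - 1 / real k \<le> real (nat \<lfloor>t * real k\<rfloor>) * (1 / real k)"
      using k unfolding fl by (simp add: diff_divide_distrib)
  qed
  show "\<forall>\<^sub>F k in sequentially. real (nat \<lfloor>t * real k\<rfloor>) * (1 / real k) \<le> t"
  proof (rule eventually_sequentiallyI[of 1])
    fix k :: nat assume k: "1 \<le> k"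
    show "real (nat \<lfloor>t * real k\<rfloor>) * (1 / real k) \<le> t"
      using k unfolding fl by (simp add: divide_le_eq)
  qed
  show "(\<lambda>k. t - 1 / real k) \<longlonglongrightarrow> t" by real_asymp
qed auto

lemma grid_index_le: "0 \<le> t \<Longrightarrow> t \<le> 1 \<Longrightarrow> nat \<lfloor>t * real k\<rfloor> \<le> k"
proof -
  assume t: "0 \<le> t" "t \<le> 1"
  then have "t * real k \<le> real k" by (simp add: mult_left_le_one_le)
  then show ?thesis by linarith
qed

lemma path_grid_tendsto:
  fixes f :: "real \<Rightarrow> 'a::topological_space"
  assumes "continuous_on {0..} f" "0 \<le> t"
  shows "(\<lambda>k. f (real (nat \<lfloor>t * real k\<rfloor>) * (1 / real k))) \<longlonglongrightarrow> f t"
  using assms by (intro continuous_on_tendsto_compose[OF assms(1) grid_tendsto]) auto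

text \<open>
  Grid points approach any two given times, so in the limit the range observed on the grid misses no
  increment of a continuous path.
\<close>

lemma increment_sq_le_liminf:
  assumes cont: "continuous_on {0..} (\<lambda>t. B t \<omega>)" and s: "0 \<le> s" "s \<le> 1" and t: "0 \<le> t" "t \<le> 1"
  shows "ennreal ((B t \<omega> - B s \<omega>)\<^sup>2)
    \<le> liminf (\<lambda>k. ennreal ((walk_range (step_increments B 1 (1 / real k) \<omega>) k)\<^sup>2))"
proof -
  define D where "D k = B (real (nat \<lfloor>t * real k\<rfloor>) * (1 / real k)) \<omega> - B (real (nat \<lfloor>s * real k\<rfloor>) * (1 / real k)) \<omega>" for k
  have "(\<lambda>k. ennreal ((D k)\<^sup>2)) \<longlonglongrightarrow> ennreal ((B t \<omega> - B s \<omega>)\<^sup>2)"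
    unfolding D_def by (intro tendsto_intros tendsto_ennrealI path_grid_tendsto[OF cont] s t)
  then have "ennreal ((B t \<omega> - B s \<omega>)\<^sup>2) = liminf (\<lambda>k. ennreal ((D k)\<^sup>2))"
    by (intro lim_imp_Liminf[symmetric]) auto
  also have "\<dots> \<le> liminf (\<lambda>k. ennreal ((walk_range (step_increments B 1 (1 / real k) \<omega>) k)\<^sup>2))"
  proof (intro Liminf_mono always_eventually allI ennreal_leI)
    fix k
    let ?d = "step_increments B 1 (1 / real k) \<omega>"
    have "D k = (\<Sum>l<nat \<lfloor>t * real k\<rfloor>. ?d l) - (\<Sum>l<nat \<lfloor>s * real k\<rfloor>. ?d l)"
      by (simp add: D_def sum_step_increments)
    then have "\<bar>D k\<bar> \<le> walk_range ?d k"
      using walk_between[OF grid_index_le[OF s, of k], of ?d] walk_between[OF grid_index_le[OF t, of k], of ?d]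
      unfolding walk_range_def by auto
    then show "(D k)\<^sup>2 \<le> (walk_range ?d k)\<^sup>2"
      by (rule abs_le_square_iff[THEN iffD1, OF order_trans[OF _ abs_ge_self]])
  qed
  finally show ?thesis .
qed

lemma path_hull_covered:
  "path_hull W t \<omega> \<subseteq> cball c r \<longleftrightarrow> (\<forall>s\<in>{0..t}. norm (W s \<omega> - c) \<le> r)"
proof -
  have "path_hull W t \<omega> \<subseteq> cball c r \<longleftrightarrow> (\<lambda>s. W s \<omega>) ` {0..t} \<subseteq> cball c r"
    unfolding path_hull_def
    using hull_minimal[of "(\<lambda>s. W s \<omega>) ` {0..t}" "cball c r" convex]
      hull_subset[of "(\<lambda>s. W s \<omega>) ` {0..t}" convex] by auto
  then show ?thesis by (auto simp: dist_norm norm_minus_commute)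
qed

lemma path_hull_bounded:
  fixes W :: "real \<Rightarrow> 'w \<Rightarrow> 'a::euclidean_space"
  assumes "continuous_on {0..} (\<lambda>s. W s \<omega>)" "0 \<le> t"
  shows "path_hull W t \<omega> \<noteq> {}" "bounded (path_hull W t \<omega>)"
proof -
  have "compact ((\<lambda>s. W s \<omega>) ` {0..t})"
    by (intro compact_continuous_image continuous_on_subset[OF assms(1)]) auto
  then show "bounded (path_hull W t \<omega>)"
    unfolding path_hull_def by (intro bounded_convex_hull compact_imp_bounded)
  show "path_hull W t \<omega> \<noteq> {}" unfolding path_hull_def using assms(2) by auto
qed

lemma ex_path_circumcenter:
  fixes W :: "real \<Rightarrow> 'w \<Rightarrow> 'a::euclidean_space"
  assumes cont: "continuous_on {0..} (\<lambda>s. W s \<omega>)" and t: "0 \<le> t"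
  obtains c where "path_hull W t \<omega> \<subseteq> cball c (circumradius (path_hull W t \<omega>))"
    "0 \<le> circumradius (path_hull W t \<omega>)"
    "\<And>c' r. path_hull W t \<omega> \<subseteq> cball c' r \<Longrightarrow> circumradius (path_hull W t \<omega>) \<le> r"
  using ex_circumcenter[OF path_hull_bounded[where W = W and \<omega> = \<omega>, OF cont t]] by blast

lemma norm_le_twice_circumradius:
  fixes W :: "real \<Rightarrow> 'w \<Rightarrow> 'a::euclidean_space"
  assumes "continuous_on {0..} (\<lambda>s. W s \<omega>)" "0 \<le> s" "s \<le> t"
  shows "norm (W s \<omega> - W 0 \<omega>) \<le> 2 * circumradius (path_hull W t \<omega>)"
proof -
  have t: "0 \<le> t" using assms by simp
  obtain c where "path_hull W t \<omega> \<subseteq> cball c (circumradius (path_hull W t \<omega>))"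
    using ex_path_circumcenter[where W = W and \<omega> = \<omega>, OF assms(1) t] by metis
  then have "norm (W s \<omega> - c) \<le> circumradius (path_hull W t \<omega>)"
    "norm (W 0 \<omega> - c) \<le> circumradius (path_hull W t \<omega>)"
    using assms t by (auto simp: path_hull_covered)
  then show ?thesis
    using norm_triangle_ineq4[of "W s \<omega> - c" "W 0 \<omega> - c"] by simp
qed

text \<open>
  The ball around the centre of the bounding box through its corners contains the path.
\<close>

lemma circumradius_sq_le_box:
  fixes W :: "real \<Rightarrow> 'w \<Rightarrow> real ^ 'n"
  assumes cont: "continuous_on {0..} (\<lambda>s. W s \<omega>)"
  shows "ennreal (4 * (circumradius (path_hull W 1 \<omega>))\<^sup>2) \<le>
    (\<Sum>i\<in>UNIV. liminf (\<lambda>k. ennreal ((walk_range (step_increments (\<lambda>t \<omega>. W t \<omega> $ i) 1 (1 / real k) \<omega>) k)\<^sup>2)))"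
proof -
  let ?R = "circumradius (path_hull W 1 \<omega>)"
  have ci: "continuous_on {0..} (\<lambda>s. W s \<omega> $ i)" for i
    by (intro continuous_intros cont)
  then have ci1: "continuous_on {0..1} (\<lambda>s. W s \<omega> $ i)" for i
    by (rule continuous_on_subset) auto
  have "\<exists>x\<in>{0..1}. \<forall>s\<in>{0..1}. W s \<omega> $ i \<le> W x \<omega> $ i" for i
    by (rule continuous_attains_sup[OF _ _ ci1]) auto
  then obtain p where p: "\<And>i. p i \<in> {0..1}" "\<And>i s. s \<in> {0..1} \<Longrightarrow> W s \<omega> $ i \<le> W (p i) \<omega> $ i" by metis
  have "\<exists>x\<in>{0..1}. \<forall>s\<in>{0..1}. W x \<omega> $ i \<le> W s \<omega> $ i" for i
    by (rule continuous_attains_inf[OF _ _ ci1]) auto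
  then obtain q where q: "\<And>i. q i \<in> {0..1}" "\<And>i s. s \<in> {0..1} \<Longrightarrow> W (q i) \<omega> $ i \<le> W s \<omega> $ i" by metis
  define w where "w i = W (p i) \<omega> $ i - W (q i) \<omega> $ i" for i
  define c :: "real ^ 'n" where "c = (\<chi> i. (W (p i) \<omega> $ i + W (q i) \<omega> $ i) / 2)"
  have "norm (W s \<omega> - c) \<le> sqrt (\<Sum>i\<in>UNIV. (w i / 2)\<^sup>2)" if s: "s \<in> {0..1}" for s
    unfolding norm_vec_def L2_set_def
  proof (intro real_sqrt_le_mono sum_mono)
    fix i
    have "\<bar>W s \<omega> $ i - c $ i\<bar> \<le> w i / 2"
      using p(2)[OF s, of i] q(2)[OF s, of i] by (simp add: c_def w_def abs_le_iff field_simps)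
    then show "(norm ((W s \<omega> - c) $ i))\<^sup>2 \<le> (w i / 2)\<^sup>2"
      by (intro power_mono) auto
  qed
  then have "path_hull W 1 \<omega> \<subseteq> cball c (sqrt (\<Sum>i\<in>UNIV. (w i / 2)\<^sup>2))"
    by (simp add: path_hull_covered)
  then have R: "0 \<le> ?R" "?R \<le> sqrt (\<Sum>i\<in>UNIV. (w i / 2)\<^sup>2)"
    using ex_path_circumcenter[where W = W and \<omega> = \<omega>, OF cont zero_le_one] by metis+
  have "?R\<^sup>2 \<le> (\<Sum>i\<in>UNIV. (w i / 2)\<^sup>2)"
    using power_mono[OF R(2) R(1), of 2] by (simp add: sum_nonneg)
  then have "4 * ?R\<^sup>2 \<le> (\<Sum>i\<in>UNIV. (w i)\<^sup>2)"
    by (simp add: power_divide sum_divide_distrib[symmetric])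
  then have "ennreal (4 * ?R\<^sup>2) \<le> (\<Sum>i\<in>UNIV. ennreal ((w i)\<^sup>2))"
    by (subst sum_ennreal) (auto intro: ennreal_leI)
  also have "\<dots> \<le> (\<Sum>i\<in>UNIV. liminf (\<lambda>k. ennreal ((walk_range (step_increments (\<lambda>t \<omega>. W t \<omega> $ i) 1 (1 / real k) \<omega>) k)\<^sup>2)))"
  proof (rule sum_mono)
    fix i
    show "ennreal ((w i)\<^sup>2) \<le> liminf (\<lambda>k. ennreal ((walk_range (step_increments (\<lambda>t \<omega>. W t \<omega> $ i) 1 (1 / real k) \<omega>) k)\<^sup>2))"
      unfolding w_def using p(1)[of i] q(1)[of i]
      by (intro increment_sq_le_liminf[where B = "\<lambda>t \<omega>. W t \<omega> $ i"] ci) auto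
  qed
  finally show ?thesis .
qed

text \<open>
  Countably many times that suffice to test a bound on a continuous path.
\<close>

definition grid_times :: "real set" where
  "grid_times = (\<lambda>(j, k). real j * (1 / real k)) ` {(j, k). j \<le> k}"

lemma countable_grid_times: "countable grid_times"
  unfolding grid_times_def by (intro countable_image countableI_type)

lemma grid_times_bounds: "s \<in> grid_times \<Longrightarrow> 0 \<le> s \<and> s \<le> 1"
  by (auto simp: grid_times_def divide_le_eq)

lemma path_bound_if_grid_bound:
  fixes f :: "real \<Rightarrow> 'a::real_normed_vector"
  assumes "continuous_on {0..} f" "0 \<le> t" "t \<le> 1" and le: "\<And>s. s \<in> grid_times \<Longrightarrow> norm (f s - c) \<le> r"
  shows "norm (f t - c) \<le> r"
proof (rule LIMSEQ_le_const2)
  show "(\<lambda>k. norm (f (real (nat \<lfloor>t * real k\<rfloor>) * (1 / real k)) - c)) \<longlonglongrightarrow> norm (f t - c)"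
    by (intro tendsto_intros path_grid_tendsto assms)
  have "real (nat \<lfloor>t * real k\<rfloor>) * (1 / real k) \<in> grid_times" for k
    unfolding grid_times_def using grid_index_le[OF assms(2,3)] by force
  then show "\<exists>N. \<forall>n\<ge>N. norm (f (real (nat \<lfloor>t * real n\<rfloor>) * (1 / real n)) - c) \<le> r"
    using le by blast
qed

text \<open>
  The radius needed around \<open>c\<close> changes by at most the distance by which \<open>c\<close> is moved, so the infimum over
  all centres may be taken over a dense set; for measurability that set will be countable.
\<close>

lemma circumradius_eq_countable:
  fixes W :: "real \<Rightarrow> 'w \<Rightarrow> 'a::euclidean_space"
  assumes cont: "continuous_on {0..} (\<lambda>s. W s \<omega>)"
    and dense: "\<And>S. open S \<Longrightarrow> S \<noteq> {} \<Longrightarrow> \<exists>c\<in>C. c \<in> S"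
  shows "(INF c\<in>C. SUP s\<in>grid_times. ennreal (norm (W s \<omega> - c))) = ennreal (circumradius (path_hull W 1 \<omega>))"
    (is "?I = ennreal ?R")
proof (rule antisym)
  obtain c where c: "path_hull W 1 \<omega> \<subseteq> cball c ?R" "0 \<le> ?R"
    and least: "\<And>c r. path_hull W 1 \<omega> \<subseteq> cball c r \<Longrightarrow> ?R \<le> r"
    using ex_path_circumcenter[where W = W and \<omega> = \<omega>, OF cont zero_le_one] by metis
  show "ennreal ?R \<le> ?I"
  proof (rule INF_greatest)
    fix c' assume "c' \<in> C"
    let ?S = "SUP s\<in>grid_times. ennreal (norm (W s \<omega> - c'))"
    show "ennreal ?R \<le> ?S"
    proof (cases ?S)
      case (real r)
      have "norm (W s \<omega> - c') \<le> r" if "s \<in> grid_times" for s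
      proof -
        have "ennreal (norm (W s \<omega> - c')) \<le> ennreal r"
          unfolding real(2)[symmetric] by (rule SUP_upper[OF that])
        then show ?thesis using real(1) by (simp add: ennreal_le_iff)
      qed
      then have "path_hull W 1 \<omega> \<subseteq> cball c' r"
        unfolding path_hull_covered using path_bound_if_grid_bound[OF cont] by auto
      then show ?thesis using least real by (simp add: ennreal_leI)
    next
      case top
      show ?thesis unfolding top by simp
    qed
  qed
  show "?I \<le> ennreal ?R"
  proof (rule ennreal_le_epsilon)
    fix e :: real assume e: "0 < e"
    obtain c' where c': "c' \<in> C" "c' \<in> ball c e"
      using dense[of "ball c e"] e by auto
    have "?I \<le> (SUP s\<in>grid_times. ennreal (norm (W s \<omega> - c')))"
      by (rule INF_lower[OF c'(1)])
    also have "\<dots> \<le> ennreal (?R + e)"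
    proof (intro SUP_least ennreal_leI)
      fix s assume "s \<in> grid_times"
      then have "norm (W s \<omega> - c) \<le> ?R"
        using c(1) grid_times_bounds by (auto simp: path_hull_covered)
      moreover have "norm (W s \<omega> - c') \<le> norm (W s \<omega> - c) + norm (c - c')"
        using norm_triangle_ineq[of "W s \<omega> - c" "c - c'"] by simp
      ultimately show "norm (W s \<omega> - c') \<le> ?R + e"
        using c'(2) by (simp add: dist_norm)
    qed
    also have "\<dots> = ennreal ?R + ennreal e" using c(2) e by (simp add: ennreal_plus)
    finally show "?I \<le> ennreal ?R + ennreal e" .
  qed
qed

lemma measurable_completion_AE:
  fixes f g :: "'a \<Rightarrow> real"
  assumes g: "g \<in> borel_measurable M" and ae: "AE x in M. f x = g x"
  shows "f \<in> borel_measurable (completion M)"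
proof (rule measurableI)
  fix A :: "real set" assume A: "A \<in> sets borel"
  show "f -` A \<inter> space (completion M) \<in> sets (completion M)"
  proof (rule completion.in_sets_AE)
    show "AE x in completion M. x \<in> g -` A \<inter> space M \<longleftrightarrow> x \<in> f -` A \<inter> space (completion M)"
      using AE_completion[OF ae] by eventually_elim simp
    show "g -` A \<inter> space M \<in> sets (completion M)"
      using measurable_sets[OF g A] by (rule sets_completionI_sets)
  qed simp
qed simp

section \<open>The two bounds\<close>

lemma confinement_prob_0: "0 < r \<Longrightarrow> confinement_prob TYPE('n::finite) r 0 = 1"
proof -
  assume r: "0 < r"
  interpret prob_space "PiM {..<0::nat} (\<lambda>_. normal_vector 1 :: ('n \<Rightarrow> real) measure)"
    by (intro prob_space_PiM prob_space_normal_vector) simp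
  have "confined r d 0" for d :: "nat \<Rightarrow> 'n \<Rightarrow> real"
    using r by (simp add: confined_def position_def sq_norm_def)
  then have "confinement_prob TYPE('n) r 0 = (\<integral>\<^sup>+d. 1 \<partial>PiM {..<0::nat} (\<lambda>_. normal_vector 1 :: ('n \<Rightarrow> real) measure))"
    unfolding confinement_prob_def by (intro nn_integral_cong) (simp add: indicator_def)
  then show ?thesis using emeasure_space_1 by simp
qed

context standard_brownian_motion
begin

lemma W_measurable: "0 \<le> t \<Longrightarrow> W t \<in> borel_measurable M"
proof -
  assume "0 \<le> t"
  then have "(\<lambda>\<omega>. W t \<omega> $ i) \<in> borel_measurable M" for i
    by (rule standard_brownian_motion_1d.measurable_B[OF coordinate_brownian])
  then have "(\<lambda>\<omega>. W t \<omega> \<bullet> b) \<in> borel_measurable M" if "b \<in> Basis" for b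
    using that by (auto simp: Basis_vec_def inner_axis)
  then show ?thesis by (subst borel_measurable_euclidean_space) auto
qed

lemma AE_path: "AE \<omega> in M. continuous_on {0..} (\<lambda>t. W t \<omega>) \<and> W 0 \<omega> = 0"
proof -
  have "AE \<omega> in M. \<forall>i\<in>UNIV. continuous_on {0..} (\<lambda>t. W t \<omega> $ i) \<and> W 0 \<omega> $ i = 0"
    by (intro AE_finite_allI AE_conjI)
      (auto intro: standard_brownian_motion_1d.continuous_paths[OF coordinate_brownian]
        standard_brownian_motion_1d.start_zero[OF coordinate_brownian])
  then show ?thesis
  proof eventually_elim
    case (elim \<omega>)
    then have "continuous_on {0..} (\<lambda>t. \<chi> i. W t \<omega> $ i)"
      by (intro continuous_on_vec_lambda) auto
    with elim show ?case by (auto simp: vec_eq_iff)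
  qed
qed

lemma measurable_version:
  obtains R where "R \<in> borel_measurable M" "\<And>\<omega>. 0 \<le> R \<omega>"
    "AE \<omega> in M. R \<omega> = circumradius (path_hull W 1 \<omega>)"
proof -
  obtain C :: "(real ^ 'n) set" where C: "countable C" "\<And>S. open S \<Longrightarrow> S \<noteq> {} \<Longrightarrow> \<exists>c\<in>C. c \<in> S"
    by (rule countable_dense_setE) blast
  define R where "R \<omega> = enn2real (INF c\<in>C. SUP s\<in>grid_times. ennreal (norm (W s \<omega> - c)))" for \<omega>
  have "(\<lambda>\<omega>. ennreal (norm (W s \<omega> - c))) \<in> borel_measurable M" if "s \<in> grid_times" for s c
  proof -
    have [measurable]: "W s \<in> borel_measurable M"
      using grid_times_bounds[OF that] by (intro W_measurable) simp
    show ?thesis by measurable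
  qed
  then have "R \<in> borel_measurable M"
    unfolding R_def
    by (intro measurable_compose[OF _ borel_measurable_enn2real] borel_measurable_INF borel_measurable_SUP
        countable_grid_times C) auto
  moreover have "AE \<omega> in M. R \<omega> = circumradius (path_hull W 1 \<omega>)"
    using AE_path
  proof eventually_elim
    case (elim \<omega>)
    then have "0 \<le> circumradius (path_hull W 1 \<omega>)"
      using ex_path_circumcenter[where W = W and \<omega> = \<omega>, OF _ zero_le_one] by metis
    with elim show ?case
      by (simp add: R_def circumradius_eq_countable[where W = W and \<omega> = \<omega>, OF _ C(2)])
  qed
  ultimately show ?thesis using that[of R] by (simp add: R_def)
qed

text \<open>
  Fatou's lemma passes from grids to the path. The grids are indexed from \<open>Suc k\<close> on, because the
  step length \<open>1 / k\<close> degenerates at \<open>k = 0\<close>.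
\<close>

lemma second_moment_circumradius:
  assumes [measurable]: "R \<in> borel_measurable M" and R: "AE \<omega> in M. R \<omega> = circumradius (path_hull W 1 \<omega>)"
  shows "(\<integral>\<^sup>+\<omega>. ennreal ((R \<omega>)\<^sup>2) \<partial>M) \<le> ennreal (real CARD('n) * ln 2)"
proof -
  let ?r = "\<lambda>i k \<omega>. ennreal ((walk_range (step_increments (\<lambda>t \<omega>. W t \<omega> $ i) 1 (1 / real k) \<omega>) k)\<^sup>2)"
  have r [measurable]: "?r i (Suc k) \<in> borel_measurable M" for i k
  proof -
    have "(\<lambda>\<omega>. \<lambda>l\<in>{..<Suc k}. step_increments (\<lambda>t \<omega>. W t \<omega> $ i) 1 (1 / real (Suc k)) \<omega> l)
        \<in> M \<rightarrow>\<^sub>M PiM {..<Suc k} (\<lambda>_. borel)"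
      by (intro measurable_restrict coord_increments_measurable) simp
    moreover have "(\<lambda>d. ennreal ((walk_range d (Suc k))\<^sup>2)) \<in> borel_measurable (PiM {..<Suc k} (\<lambda>_. borel))"
      unfolding walk_range_def
      by (intro measurable_compose[OF _ measurable_ennreal] borel_measurable_power borel_measurable_diff borel_measurable_walk) auto
    ultimately have "(\<lambda>\<omega>. ennreal ((walk_range (\<lambda>l\<in>{..<Suc k}. step_increments (\<lambda>t \<omega>. W t \<omega> $ i) 1 (1 / real (Suc k)) \<omega> l) (Suc k))\<^sup>2))
        \<in> borel_measurable M"
      by (rule measurable_compose)
    moreover have "walk_range (\<lambda>l\<in>{..<Suc k}. d l) (Suc k) = walk_range d (Suc k)" for d
      unfolding walk_range_def by (intro arg_cong2[where f = minus] walk_cong) auto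
    ultimately show ?thesis by simp
  qed
  have shift: "liminf (\<lambda>k. f (Suc k)) = liminf f" for f :: "nat \<Rightarrow> ennreal"
    using liminf_shift[of f] by simp
  have "4 * (\<integral>\<^sup>+\<omega>. ennreal ((R \<omega>)\<^sup>2) \<partial>M) = (\<integral>\<^sup>+\<omega>. ennreal (4 * (R \<omega>)\<^sup>2) \<partial>M)"
    by (simp add: ennreal_mult' nn_integral_cmult)
  also have "\<dots> \<le> (\<integral>\<^sup>+\<omega>. (\<Sum>i\<in>UNIV. liminf (\<lambda>k. ?r i (Suc k) \<omega>)) \<partial>M)"
  proof (rule nn_integral_mono_AE)
    show "AE \<omega> in M. ennreal (4 * (R \<omega>)\<^sup>2) \<le> (\<Sum>i\<in>UNIV. liminf (\<lambda>k. ?r i (Suc k) \<omega>))"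
      using AE_path R
    proof eventually_elim
      case (elim \<omega>)
      then show ?case
        unfolding shift[of "\<lambda>k. ?r _ k \<omega>"] using circumradius_sq_le_box[where W = W and \<omega> = \<omega>] by simp
    qed
  qed
  also have "\<dots> = (\<Sum>i\<in>UNIV. \<integral>\<^sup>+\<omega>. liminf (\<lambda>k. ?r i (Suc k) \<omega>) \<partial>M)"
    by (rule nn_integral_sum) (use r in measurable)
  also have "\<dots> \<le> (\<Sum>i\<in>(UNIV :: 'n set). ennreal (4 * ln 2))"
  proof (rule sum_mono)
    fix i
    have "(\<integral>\<^sup>+\<omega>. liminf (\<lambda>k. ?r i (Suc k) \<omega>) \<partial>M) \<le> liminf (\<lambda>k. \<integral>\<^sup>+\<omega>. ?r i (Suc k) \<omega> \<partial>M)"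
      by (rule nn_integral_liminf) (rule r)
    also have "(\<lambda>k. \<integral>\<^sup>+\<omega>. ?r i (Suc k) \<omega> \<partial>M) = (\<lambda>k. mean_sq_range (sqrt (1 / real (Suc k))) (Suc k))"
      by (intro ext standard_brownian_motion_1d.mean_sq_range_grid[OF coordinate_brownian]) auto
    also have "liminf \<dots> \<le> ennreal (4 * ln 2)"
      unfolding shift[of "\<lambda>k. mean_sq_range (sqrt (1 / real k)) k"] by (rule liminf_mean_sq_range_le)
    finally show "(\<integral>\<^sup>+\<omega>. liminf (\<lambda>k. ?r i (Suc k) \<omega>) \<partial>M) \<le> ennreal (4 * ln 2)" .
  qed
  also have "\<dots> = 4 * ennreal (real CARD('n) * ln 2)"
    by (simp add: ennreal_of_nat_eq_real_of_nat ennreal_mult'[symmetric] ennreal_numeral[symmetric] mult_ac del: ennreal_numeral)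
  finally show ?thesis by (simp add: ennreal_mult_le_mult_iff)
qed

text \<open>
  This is where scaling enters the lower bound: after multiplication by \<open>sqrt k\<close> the path observed at
  the times \<open>j / k\<close> is a walk with standard normal steps, and twice the circumradius dominates the
  norms of its positions before scaling.
\<close>

lemma circumradius_confinement:
  assumes [measurable]: "R \<in> borel_measurable M" and R: "AE \<omega> in M. R \<omega> = circumradius (path_hull W 1 \<omega>)"
    and r: "0 < r"
  shows "emeasure M {\<omega> \<in> space M. 2 * R \<omega> * sqrt (real k) < r} \<le> confinement_prob TYPE('n) r k"
proof (cases "k = 0")
  case True
  have "confinement_prob TYPE('n) r k = 1"
    unfolding True by (rule confinement_prob_0[OF r])
  then show ?thesis using emeasure_le_1 by simp
next
  case False
  define h where "h = 1 / real k"
  have h: "0 < h" and k: "0 < k" using False by (auto simp: h_def)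
  have "emeasure M {\<omega> \<in> space M. 2 * R \<omega> * sqrt (real k) < r}
      \<le> emeasure M {\<omega> \<in> space M. confined r (coord_increments (1 / sqrt h) h \<omega>) k}"
  proof (rule emeasure_mono_AE)
    show "AE \<omega> in M. \<omega> \<in> {\<omega> \<in> space M. 2 * R \<omega> * sqrt (real k) < r} \<longrightarrow>
        \<omega> \<in> {\<omega> \<in> space M. confined r (coord_increments (1 / sqrt h) h \<omega>) k}"
      using AE_path R
    proof eventually_elim
      case (elim \<omega>)
      have "confined r (coord_increments (1 / sqrt h) h \<omega>) k" if small: "2 * R \<omega> * sqrt (real k) < r"
        unfolding confined_def
      proof (intro allI impI)
        fix j assume j: "j \<le> k"
        have pos: "position (coord_increments (1 / sqrt h) h \<omega>) j i = sqrt (real k) * (W (real j * h) \<omega> $ i)" for i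
          using elim by (simp add: position_def sum_step_increments h_def real_sqrt_divide)
        have "norm (W (real j * h) \<omega> - W 0 \<omega>) \<le> 2 * circumradius (path_hull W 1 \<omega>)"
          using elim j k by (intro norm_le_twice_circumradius[where W = W and \<omega> = \<omega>]) (auto simp: h_def)
        then have "sqrt (real k) * norm (W (real j * h) \<omega>) \<le> sqrt (real k) * (2 * R \<omega>)"
          using elim by (intro mult_left_mono) auto
        with small have "sqrt (real k) * norm (W (real j * h) \<omega>) < r" by (simp add: mult_ac)
        then have "(sqrt (real k) * norm (W (real j * h) \<omega>))\<^sup>2 < r\<^sup>2"
          by (intro power_strict_mono) auto
        moreover have "sq_norm (position (coord_increments (1 / sqrt h) h \<omega>) j) = (sqrt (real k) * norm (W (real j * h) \<omega>))\<^sup>2"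
          unfolding sq_norm_def pos
          by (simp add: power_mult_distrib norm_vec_def L2_set_def sum_nonneg sum_distrib_left)
        ultimately show "sq_norm (position (coord_increments (1 / sqrt h) h \<omega>) j) < r\<^sup>2" by simp
      qed
      then show ?case by auto
    qed
  qed (rule confinement_prob_grid(2)[OF h k])
  then show ?thesis unfolding confinement_prob_grid(1)[OF h k] .
qed

end

theorem theorem5:
  fixes M :: "'w measure" and W :: "real \<Rightarrow> 'w \<Rightarrow> real ^ 'n"
  assumes "standard_brownian_motion M W"
  shows "integrable (completion M) (\<lambda>\<omega>. circumradius (path_hull W 1 \<omega>)) \<and>
    1 / 2 * sqrt (real CARD('n)) \<le> expected_circumradius M W 1 \<and>
    expected_circumradius M W 1 \<le> sqrt (ln 2) * sqrt (real CARD('n))"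
proof -
  interpret standard_brownian_motion M W by fact
  obtain R where R_meas [measurable]: "R \<in> borel_measurable M" and R_nonneg: "\<And>\<omega>. 0 \<le> R \<omega>"
    and R: "AE \<omega> in M. R \<omega> = circumradius (path_hull W 1 \<omega>)"
    by (rule measurable_version) blast
  define V where "V = real CARD('n) * ln 2"
  have V: "0 < V" by (simp add: V_def)
  have sq: "(\<integral>\<^sup>+\<omega>. ennreal ((R \<omega>)\<^sup>2) \<partial>M) \<le> ennreal V"
    unfolding V_def by (rule second_moment_circumradius[OF R_meas R])
  have int_sq: "integrable M (\<lambda>\<omega>. (R \<omega>)\<^sup>2)"
    by (rule integrableI_bounded) (use le_less_trans[OF sq ennreal_less_top] in auto)
  have "ennreal (expectation (\<lambda>\<omega>. (R \<omega>)\<^sup>2)) \<le> ennreal V"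
    using sq by (subst (asm) nn_integral_eq_integral[OF int_sq]) auto
  then have exp_sq: "expectation (\<lambda>\<omega>. (R \<omega>)\<^sup>2) \<le> V" using V by simp
  \<comment> \<open>A tangent line of the square, optimal at R = sqrt V, replaces the Cauchy-Schwarz inequality and yields integrability as well.\<close>
  have amgm: "R \<omega> \<le> (R \<omega>)\<^sup>2 / (2 * sqrt V) + sqrt V / 2" for \<omega>
  proof -
    have "0 \<le> (R \<omega> - sqrt V)\<^sup>2" by simp
    then have "2 * sqrt V * R \<omega> \<le> (R \<omega>)\<^sup>2 + sqrt V * sqrt V"
      by (simp add: power2_eq_square algebra_simps)
    then show ?thesis using V by (simp add: field_simps)
  qed
  have int_bound: "integrable M (\<lambda>\<omega>. (R \<omega>)\<^sup>2 / (2 * sqrt V) + sqrt V / 2)"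
    using int_sq by simp
  have int_R: "integrable M R"
    by (rule Bochner_Integration.integrable_bound[OF int_bound R_meas])
      (use amgm R_nonneg in \<open>auto intro!: AE_I2 order_trans[OF amgm abs_ge_self]\<close>)
  have "expectation R \<le> expectation (\<lambda>\<omega>. (R \<omega>)\<^sup>2 / (2 * sqrt V) + sqrt V / 2)"
    by (rule integral_mono[OF int_R int_bound amgm])
  also have "\<dots> = expectation (\<lambda>\<omega>. (R \<omega>)\<^sup>2) / (2 * sqrt V) + sqrt V / 2"
    using int_sq by (simp add: prob_space)
  also have "\<dots> \<le> V / (2 * sqrt V) + sqrt V / 2"
    using exp_sq V by (intro add_right_mono divide_right_mono) auto
  also have "\<dots> = sqrt V"
    using V by (simp add: field_simps)
  finally have upper: "expectation R \<le> sqrt (ln 2) * sqrt (real CARD('n))"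
    by (simp add: V_def real_sqrt_mult mult.commute)
  have "sqrt (real CARD('n)) \<le> expectation (\<lambda>\<omega>. 2 * R \<omega>)"
  proof (rule sqrt_dim_le_expectation)
    show "integrable M (\<lambda>\<omega>. 2 * R \<omega>)" using int_R by simp
    show "AE \<omega> in M. 0 \<le> 2 * R \<omega>" using R_nonneg by simp
    show "emeasure M {\<omega> \<in> space M. 2 * R \<omega> * sqrt (real k) < r} \<le> confinement_prob TYPE('n) r k"
      if "0 < r" for k r
      by (rule circumradius_confinement[OF R_meas R that])
  qed
  then have lower: "1 / 2 * sqrt (real CARD('n)) \<le> expectation R" by simp
  have circ_meas: "(\<lambda>\<omega>. circumradius (path_hull W 1 \<omega>)) \<in> borel_measurable (completion M)"
    by (rule measurable_completion_AE[OF R_meas]) (use R in \<open>auto elim: eventually_mono\<close>)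
  have ae: "AE \<omega> in completion M. R \<omega> = circumradius (path_hull W 1 \<omega>)"
    by (rule AE_completion[OF R])
  have R_meas': "R \<in> borel_measurable (completion M)" by (rule measurable_completion[OF R_meas])
  have "integrable (completion M) R" using int_R by (simp add: integrable_completion)
  then have "integrable (completion M) (\<lambda>\<omega>. circumradius (path_hull W 1 \<omega>))"
    using integrable_cong_AE[OF R_meas' circ_meas ae] by simp
  moreover have "expected_circumradius M W 1 = expectation R"
    unfolding expected_circumradius_def
    using integral_cong_AE[OF R_meas' circ_meas ae] integral_completion[OF R_meas] by simp
  ultimately show ?thesis using upper lower by simp
qed

end
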